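(* Let $(\mathfrak{g},\mathfrak{n})$ be a pair of complex Lie algebras on the same underlying vector space, where $\mathfrak{g}$ is isomorphic either to $\mathfrak{sl}_2(\mathbb{C})\ltimes V(3)$ or to $\mathfrak{sl}_2(\mathbb{C})\ltimes\mathfrak{n}_3(\mathbb{C})$, and $\mathfrak{n}$ is nilpotent. Then there is no PA-structure on $(\mathfrak{g},\mathfrak{n})$.
   Context: $V(n)$ denotes the irreducible $\mathfrak{sl}_2(\mathbb{C})$-module of dimension $n$; in $\mathfrak{sl}_2(\mathbb{C})\ltimes V(3)$ the module $V(3)$ is regarded as an abelian ideal. The Lie algebra $\mathfrak{sl}_2(\mathbb{C})\ltimes\mathfrak{n}_3(\mathbb{C})$, where $\mathfrak{n}_3(\mathbb{C})$ is the $3$-dimensional Heisenberg Lie algebra, has basis $(e_1,\ldots,e_6)$ with $\mathfrak{sl}_2(\mathbb{C})=\mathrm{span}\{e_1,e_2,e_3\}$, $\mathfrak{n}_3(\mathbb{C})=\mathrm{span}\{e_4,e_5,e_6\}$ and nonzero brackets (up to antisymmetry) $[e_1,e_2]=e_3$, $[e_1,e_3]=-2e_1$, $[e_2,e_3]=2e_2$, $[e_1,e_5]=e_4$, $[e_2,e_4]=e_5$, $[e_3,e_4]=e_4$, $[e_3,e_5]=-e_5$, $[e_4,e_5]=e_6$. Let $\mathfrak{g}=(V,[\,,])$ and $\mathfrak{n}=(V,\{\,,\})$ be two Lie algebra structures on the same vector space $V$ over $\mathbb{C}$. A post-Lie algebra structure (PA-structure) on the pair $(\mathfrak{g},\mathfrak{n})$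 is a $\mathbb{C}$-bilinear product $(x,y)\mapsto x\cdot y$ on $V$ satisfying, for all $x,y,z\in V$: (1) $x\cdot y-y\cdot x=[x,y]-\{x,y\}$; (2) $[x,y]\cdot z=x\cdot(y\cdot z)-y\cdot(x\cdot z)$; (3) $x\cdot\{y,z\}=\{x\cdot y,z\}+\{y,x\cdot z\}$. When the algebras of a pair are specified only up to isomorphism, "there is no PA-structure" means that none exists for any two brackets on a common vector space $V$ giving Lie algebras of the specified types. *)

theory Defs
  imports "HOL-Analysis.Analysis"
begin

locale lie_algebra = vector_space sc
  for sc :: "complex \<Rightarrow> 'a::ab_group_add \<Rightarrow> 'a" +
  fixes br :: "'a \<Rightarrow> 'a \<Rightarrow> 'a"
  assumes br_linear_right: "\<And>x. Vector_Spaces.linear sc sc (br x)"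
    and br_linear_left: "\<And>y. Vector_Spaces.linear sc sc (\<lambda>x. br x y)"
    and br_alternating: "\<And>x. br x x = 0"
    and jacobi: "\<And>x y z. br x (br y z) + br y (br z x) + br z (br x y) = 0"
begin

primrec lower_central :: "nat \<Rightarrow> 'a set" where
  "lower_central 0 = UNIV"
| "lower_central (Suc k) = span {br x y | x y. y \<in> lower_central k}"

definition nilpotent :: bool where
  "nilpotent \<longleftrightarrow> (\<exists>k. lower_central k = {0})"

end

text \<open>An isomorphism onto a Lie algebra whose underlying space is the subspace \<open>S\<close> of a
  complex vector space with scalar multiplication \<open>sc'\<close>.\<close>

definition lie_isomorphic ::
  "(complex \<Rightarrow> 'a::ab_group_add \<Rightarrow> 'a) \<Rightarrow> ('a \<Rightarrow> 'a \<Rightarrow> 'a) \<Rightarrow>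
   (complex \<Rightarrow> 'b::ab_group_add \<Rightarrow> 'b) \<Rightarrow> 'b set \<Rightarrow> ('b \<Rightarrow> 'b \<Rightarrow> 'b) \<Rightarrow> bool" where
  "lie_isomorphic sc br sc' S br' \<longleftrightarrow>
     (\<exists>\<phi>. Vector_Spaces.linear sc sc' \<phi> \<and> bij_betw \<phi> UNIV S \<and>
          (\<forall>x y. \<phi> (br x y) = br' (\<phi> x) (\<phi> y)))"

definition mscale :: "complex \<Rightarrow> complex^2^2 \<Rightarrow> complex^2^2" where
  "mscale c A = (\<chi> i j. c * A$i$j)"

definition commutator :: "complex^2^2 \<Rightarrow> complex^2^2 \<Rightarrow> complex^2^2" where
  "commutator A B = A ** B - B ** A"

definition sl2 :: "(complex^2^2) set" where
  "sl2 = {A. trace A = 0}"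

text \<open>Only the values of \<open>\<rho>\<close> on \<^const>\<open>sl2\<close> matter below.\<close>

definition sl2_module :: "(complex^2^2 \<Rightarrow> complex^'n \<Rightarrow> complex^'n) \<Rightarrow> bool" where
  "sl2_module \<rho> \<longleftrightarrow>
     (\<forall>A\<in>sl2. Vector_Spaces.linear (*s) (*s) (\<rho> A)) \<and>
     (\<forall>A\<in>sl2. \<forall>B\<in>sl2. \<forall>v. \<rho> (A + B) v = \<rho> A v + \<rho> B v) \<and>
     (\<forall>c. \<forall>A\<in>sl2. \<forall>v. \<rho> (mscale c A) v = c *s \<rho> A v) \<and>
     (\<forall>A\<in>sl2. \<forall>B\<in>sl2. \<forall>v. \<rho> (commutator A B) v = \<rho> A (\<rho> B v) - \<rho> B (\<rho> A v))"

text \<open>The zero module is excluded automatically, since \<open>complex^'n\<close> has positive dimension.\<close>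

definition irreducible_sl2_module :: "(complex^2^2 \<Rightarrow> complex^'n \<Rightarrow> complex^'n) \<Rightarrow> bool" where
  "irreducible_sl2_module \<rho> \<longleftrightarrow>
     sl2_module \<rho> \<and>
     (\<forall>W. vec.subspace W \<and> (\<forall>A\<in>sl2. \<forall>w\<in>W. \<rho> A w \<in> W) \<longrightarrow> W = {0} \<or> W = UNIV)"

definition semidirect_scale ::
  "complex \<Rightarrow> (complex^2^2) \<times> (complex^'n) \<Rightarrow> (complex^2^2) \<times> (complex^'n)" where
  "semidirect_scale c = (\<lambda>(A, u). (mscale c A, c *s u))"

text \<open>The bracket of \<open>sl2 \<ltimes> \<aa>\<close>, where \<open>\<aa>\<close> is \<open>complex^'n\<close> with bracket \<open>b\<close> and
  \<^const>\<open>sl2\<close> acts on \<open>\<aa>\<close> through \<open>\<rho>\<close>.\<close>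

definition semidirect_bracket ::
  "(complex^2^2 \<Rightarrow> complex^'n \<Rightarrow> complex^'n) \<Rightarrow> (complex^'n \<Rightarrow> complex^'n \<Rightarrow> complex^'n) \<Rightarrow>
   (complex^2^2) \<times> (complex^'n) \<Rightarrow> (complex^2^2) \<times> (complex^'n) \<Rightarrow>
   (complex^2^2) \<times> (complex^'n)" where
  "semidirect_bracket \<rho> b = (\<lambda>(A, u) (B, v). (commutator A B, \<rho> A v - \<rho> B u + b u v))"

definition iso_sl2_V3 ::
  "(complex \<Rightarrow> 'a::ab_group_add \<Rightarrow> 'a) \<Rightarrow> ('a \<Rightarrow> 'a \<Rightarrow> 'a) \<Rightarrow> bool" where
  "iso_sl2_V3 sc br \<longleftrightarrow>
     (\<exists>\<rho> :: complex^2^2 \<Rightarrow> complex^3 \<Rightarrow> complex^3. irreducible_sl2_module \<rho> \<and>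
        lie_isomorphic sc br semidirect_scale (sl2 \<times> UNIV)
          (semidirect_bracket \<rho> (\<lambda>_ _. 0)))"

text \<open>The Heisenberg Lie algebra on \<open>complex^3\<close>: the standard basis satisfies
  \<open>[b1, b2] = b3\<close> with \<open>b3\<close> central. The action of \<^const>\<open>sl2\<close> on it is the natural
  representation on \<open>span {b1, b2}\<close> and trivial on \<open>b3\<close>.\<close>

definition heisenberg_bracket :: "complex^3 \<Rightarrow> complex^3 \<Rightarrow> complex^3" where
  "heisenberg_bracket u v = vector [0, 0, u$1 * v$2 - u$2 * v$1]"

definition heisenberg_action :: "complex^2^2 \<Rightarrow> complex^3 \<Rightarrow> complex^3" where
  "heisenberg_action A v =
     vector [A$1$1 * v$1 + A$1$2 * v$2, A$2$1 * v$1 + A$2$2 * v$2, 0]"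

abbreviation sl2_n3_bracket ::
  "(complex^2^2) \<times> (complex^3) \<Rightarrow> (complex^2^2) \<times> (complex^3) \<Rightarrow> (complex^2^2) \<times> (complex^3)" where
  "sl2_n3_bracket \<equiv> semidirect_bracket heisenberg_action heisenberg_bracket"

definition iso_sl2_n3 ::
  "(complex \<Rightarrow> 'a::ab_group_add \<Rightarrow> 'a) \<Rightarrow> ('a \<Rightarrow> 'a \<Rightarrow> 'a) \<Rightarrow> bool" where
  "iso_sl2_n3 sc br \<longleftrightarrow>
     lie_isomorphic sc br semidirect_scale (sl2 \<times> UNIV) sl2_n3_bracket"

text \<open>A post-Lie algebra structure on the pair with brackets \<open>brg\<close> and \<open>brn\<close>, in this order.\<close>

definition pa_structure ::
  "(complex \<Rightarrow> 'a::ab_group_add \<Rightarrow> 'a) \<Rightarrow> ('a \<Rightarrow> 'a \<Rightarrow> 'a) \<Rightarrow> ('a \<Rightarrow> 'a \<Rightarrow> 'a) \<Rightarrow>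
   ('a \<Rightarrow> 'a \<Rightarrow> 'a) \<Rightarrow> bool" where
  "pa_structure sc brg brn p \<longleftrightarrow>
     (\<forall>x. Vector_Spaces.linear sc sc (p x)) \<and>
     (\<forall>y. Vector_Spaces.linear sc sc (\<lambda>x. p x y)) \<and>
     (\<forall>x y. p x y - p y x = brg x y - brn x y) \<and>
     (\<forall>x y z. p (brg x y) z = p x (p y z) - p y (p x z)) \<and>
     (\<forall>x y z. p x (brn y z) = brn (p x y) z + brn y (p x z))"

lemma vector_space_semidirect_scale:
  "vector_space (semidirect_scale :: complex \<Rightarrow> _ \<Rightarrow> (complex^2^2) \<times> (complex^'n))"
  by unfold_locales
    (auto simp: semidirect_scale_def mscale_def vec_eq_iff algebra_simps)

text \<open>The bracket table of \<open>sl2 \<ltimes> n3\<close> in the basis \<open>(e1, ..., e6)\<close>; all brackets of basis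
  elements are determined by these and antisymmetry.\<close>

lemma sl2_n3_table:
  defines "e1 \<equiv> (vector [vector [0, 1], vector [0, 0]], 0)"
    and "e2 \<equiv> (vector [vector [0, 0], vector [1, 0]], 0)"
    and "e3 \<equiv> (vector [vector [1, 0], vector [0, -1]], 0)"
    and "e4 \<equiv> (0, vector [1, 0, 0])"
    and "e5 \<equiv> (0, vector [0, 1, 0])"
    and "e6 \<equiv> (0, vector [0, 0, 1])"
  shows "sl2_n3_bracket e1 e2 = e3"
    and "sl2_n3_bracket e1 e3 = semidirect_scale (-2) e1"
    and "sl2_n3_bracket e2 e3 = semidirect_scale 2 e2"
    and "sl2_n3_bracket e1 e4 = 0" and "sl2_n3_bracket e1 e5 = e4" and "sl2_n3_bracket e1 e6 = 0"
    and "sl2_n3_bracket e2 e4 = e5" and "sl2_n3_bracket e2 e5 = 0" and "sl2_n3_bracket e2 e6 = 0"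
    and "sl2_n3_bracket e3 e4 = e4" and "sl2_n3_bracket e3 e5 = - e5" and "sl2_n3_bracket e3 e6 = 0"
    and "sl2_n3_bracket e4 e5 = e6" and "sl2_n3_bracket e4 e6 = 0" and "sl2_n3_bracket e5 e6 = 0"
  by (simp_all add: e1_def e2_def e3_def e4_def e5_def e6_def semidirect_bracket_def
      semidirect_scale_def mscale_def commutator_def heisenberg_action_def heisenberg_bracket_def
      matrix_matrix_mult_def vec_eq_iff forall_2 forall_3 sum_2 zero_prod_def)

end

theory Submission
  imports Defs
begin

text \<open>
  Write \<open>{,}\<close> for the bracket of \<open>\<nn>\<close> and \<open>L x\<close> for the map \<open>y \<mapsto> x \<cdot> y\<close>. The axioms of a PA-structure say
  that every \<open>L x\<close> is a derivation of \<open>\<nn>\<close> and that \<open>x \<mapsto> (x, L x)\<close> is a homomorphism from \<open>\<gg>\<close> to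
  the semidirect product of \<open>\<nn>\<close> with its derivations. So \<open>\<gg>\<close> acts by affine vector fields on
  the simply connected group \<open>N\<close> of the nilpotent Lie algebra \<open>\<nn>\<close>, and the evaluation of these fields at the identity of \<open>N\<close> is the
  identity map of the common vector space. Evaluation at another point of \<open>N\<close>, pulled back to the
  identity by translation, is another linear map \<open>E\<close> for which \<open>x \<mapsto> (E x, L x)\<close> is a homomorphism,
  a crossed homomorphism. Two facts about these maps contradict each other.

  The determinant of \<open>E\<close> does not depend on the base point. Moving the base point
  along \<open>exp (t y)\<close> changes \<open>E\<close> by \<open>E' x = x \<cdot> y - {y, E x}\<close>. Where \<open>E\<close> is invertible, write
  \<open>y = E z\<close>; the crossed homomorphism identity turns the right-hand side into
  \<open>z \<cdot> E x - E [z, x]\<close>, so the logarithmic derivative of \<open>det E\<close> is \<open>tr (L z) - tr (ad z)\<close>. This is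
  zero because \<open>\<gg>\<close> is perfect and a trace vanishes on commutators. So the derivative of
  \<open>(det E)\<^sup>2\<close> vanishes everywhere (\<open>det_flow_constant\<close>), and \<open>E\<close> is invertible at every
  base point.

  On the other hand, the subalgebra \<open>sl2\<close> of \<open>\<gg>\<close> has a fixed point in \<open>N\<close>, at which \<open>E\<close> kills
  \<open>sl2\<close>. It is reached by finitely many changes of base point, which push \<open>E sl2\<close> down the lower
  central series of \<open>\<nn>\<close> one step at a time (\<open>ex_crossed_hom_in_lower_central\<close>): once
  \<open>E sl2\<close> lies in the \<open>k\<close>-th term, \<open>E\<close> induces a cocycle of \<open>sl2\<close> with values in the \<open>k\<close>-th quotient
  of the series, and this cocycle is a coboundary by Whitehead's lemma
  (\<open>ex_trivializing_vector_mod_subspace\<close>). Whitehead's lemma itself comes from the Casimir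
  operator: its kernel consists of invariants and equals the kernel of its square, so every
  finite-dimensional representation is the sum of its invariants and the image of the Casimir operator.

  The argument applies to every perfect \<open>\<gg>\<close> that contains a nonzero \<open>sl2\<close>-triple. The last part checks
  that both semidirect products in question are perfect.
\<close>

section \<open>Polynomials in a linear operator\<close>

text \<open>Horner's scheme for the polynomial \<open>p\<close> in the operator \<open>T\<close>, applied to \<open>v\<close>.\<close>

definition poly_op ::
  "('k::comm_ring_1 \<Rightarrow> 'v \<Rightarrow> 'v) \<Rightarrow> ('v \<Rightarrow> 'v) \<Rightarrow> 'k poly \<Rightarrow> 'v \<Rightarrow> 'v::ab_group_add" where
  "poly_op s T p v = fold_coeffs (\<lambda>a w. s a v + T w) p 0"

locale vector_space_operator = vector_space s
  for s :: "'k::field \<Rightarrow> 'v::ab_group_add \<Rightarrow> 'v" +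
  fixes T :: "'v \<Rightarrow> 'v"
  assumes linear_T: "Vector_Spaces.linear s s T"
begin

lemmas T_simps = Vector_Spaces.linear_iff[THEN iffD1, OF linear_T]

lemma T_add: "T (x + y) = T x + T y" and T_scale: "T (s c x) = s c (T x)"
  using T_simps by auto

lemma T_0 [simp]: "T 0 = 0"
  using T_scale[of 0 0] by simp

lemma T_diff: "T (x - y) = T x - T y"
  using T_add[of "x - y" y] by simp

abbreviation op :: "'k poly \<Rightarrow> 'v \<Rightarrow> 'v" where "op \<equiv> poly_op s T"

lemma op_0 [simp]: "op 0 v = 0"
  by (simp add: poly_op_def)

lemma op_pCons: "op (pCons a p) v = s a v + T (op p v)"
  by (cases "a = 0 \<and> p = 0") (auto simp: poly_op_def)

lemma op_const [simp]: "op [:a:] v = s a v"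
  by (simp add: op_pCons)

lemma op_1 [simp]: "op 1 v = v"
  by (simp add: one_pCons)

lemma op_linear_factor: "op [:a, 1:] v = s a v + T v"
  by (simp add: op_pCons)

lemma op_add: "op (p + q) v = op p v + op q v"
  by (induction p q rule: poly_induct2) (simp_all add: op_pCons T_add algebra_simps)

lemma op_smult: "op (smult c p) v = s c (op p v)"
  by (induction p) (simp_all add: op_pCons T_scale algebra_simps)

lemma op_mult: "op (p * q) v = op p (op q v)"
  by (induction p) (simp_all add: op_pCons op_add op_smult)

lemma op_diff: "op (p - q) v = op p v - op q v"
  using op_add[of "p - q" q v] by simp

lemma op_commute: "op p (op q v) = op q (op p v)"
  by (metis op_mult mult.commute)

lemma op_vector_add: "op p (v + w) = op p v + op p w"
  by (induction p) (simp_all add: op_pCons T_add algebra_simps)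

lemma op_vector_scale: "op p (s c v) = s c (op p v)"
  by (induction p) (simp_all add: op_pCons T_scale algebra_simps)

lemma op_vector_0 [simp]: "op p 0 = 0"
  using op_vector_scale[of p 0 0] by simp

lemma T_op: "T (op p v) = op p (T v)"
  by (induction p) (simp_all add: op_pCons T_add T_scale)

lemma op_monom: "op (monom c n) v = s c ((T ^^ n) v)"
  by (induction n) (simp_all add: monom_0 monom_Suc op_pCons T_scale)

lemma op_eigenvector:
  assumes "T v = s c v"
  shows "op p v = s (poly p c) v"
  using assms by (induction p) (simp_all add: op_pCons T_scale algebra_simps)

text \<open>Apply the linear factors to \<open>v\<close> one after the other; the last vector before 0 is an eigenvector.\<close>

lemma eigenvector_if_split_annihilator:
  assumes "subspace U" "\<And>u. u \<in> U \<Longrightarrow> T u \<in> U"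
    and "v \<in> U" "v \<noteq> 0" "op (\<Prod>a\<leftarrow>as. [:a, 1:]) v = 0"
  shows "\<exists>a\<in>set as. \<exists>u\<in>U. u \<noteq> 0 \<and> T u = s (- a) u"
  using assms(3-5)
proof (induction as arbitrary: v)
  case Nil
  then show ?case by simp
next
  case (Cons a as)
  show ?case
  proof (cases "op [:a, 1:] v = 0")
    case True
    then have "T v = s (- a) v"
      by (simp add: op_linear_factor eq_neg_iff_add_eq_0 add.commute)
    with Cons.prems show ?thesis by auto
  next
    case False
    have "op [:a, 1:] v \<in> U"
      using Cons.prems assms(1,2) by (simp add: op_linear_factor subspace_add subspace_scale)
    moreover have "op (\<Prod>a\<leftarrow>as. [:a, 1:]) (op [:a, 1:] v) = 0"
      using Cons.prems(3) by (metis list.simps(9) prod_list.Cons op_mult op_commute)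
    ultimately show ?thesis
      using Cons.IH False by force
  qed
qed

end

text \<open>The vectors \<open>v, T v, T\<^sup>2 v, \<dots>\<close> satisfy a linear relation.\<close>

lemma (in finite_dimensional_vector_space) ex_annihilating_poly_at:
  assumes "Vector_Spaces.linear scale scale T"
  shows "\<exists>p. p \<noteq> 0 \<and> poly_op scale T p v = 0"
proof -
  interpret vector_space_operator scale T
    by (intro vector_space_operator.intro vector_space_operator_axioms.intro vector_space_axioms assms)
  show ?thesis
  proof (cases "inj_on (\<lambda>i. (T ^^ i) v) {..dimension}")
    case False
    then obtain i j where ij: "i \<noteq> j" "(T ^^ i) v = (T ^^ j) v"
      by (auto simp: inj_on_def)
    have "monom 1 i - monom 1 j \<noteq> (0 :: 'a poly)"
      using ij(1) by (simp add: poly_eq_iff) (metis one_neq_zero)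
    moreover have "op (monom 1 i - monom 1 j) v = 0"
      using ij(2) by (simp add: op_diff op_monom)
    ultimately show ?thesis by blast
  next
    case True
    let ?S = "(\<lambda>i. (T ^^ i) v) ` {..dimension}"
    have "dependent ?S"
      using True dim_subset_UNIV[of ?S]
      by (intro dependent_biggerset_general) (simp add: card_image)
    then obtain u where u: "\<exists>x\<in>?S. u x \<noteq> 0" "(\<Sum>x\<in>?S. scale (u x) x) = 0"
      by (subst (asm) dependent_finite) auto
    define p where "p = (\<Sum>i\<le>dimension. monom (u ((T ^^ i) v)) i)"
    have "coeff p i = u ((T ^^ i) v)" if "i \<le> dimension" for i
      using that by (simp add: p_def coeff_sum)
    then have "p \<noteq> 0"
      using u(1) by fastforce
    moreover have "op (\<Sum>i\<in>I. monom (c i) i) v = (\<Sum>i\<in>I. scale (c i) ((T ^^ i) v))"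
      if "finite I" for I c
      using that by induction (simp_all add: op_add op_monom)
    then have "op p v = 0"
      using u(2) True by (simp add: p_def sum.reindex)
    ultimately show ?thesis by blast
  qed
qed

text \<open>The product of polynomials that annihilate the single basis vectors annihilates everything.\<close>

lemma (in finite_dimensional_vector_space) ex_annihilating_poly:
  assumes "Vector_Spaces.linear scale scale T"
  shows "\<exists>p. p \<noteq> 0 \<and> (\<forall>v. poly_op scale T p v = 0)"
proof -
  interpret vector_space_operator scale T
    by (intro vector_space_operator.intro vector_space_operator_axioms.intro vector_space_axioms assms)
  have "\<exists>p. p \<noteq> 0 \<and> (\<forall>b\<in>B. op p b = 0)" if "finite B" for B
    using that
  proof induction
    case empty
    show ?case by (intro exI[of _ 1]) auto
  next
    case (insert b B)
    obtain p q where "p \<noteq> 0" "\<forall>b\<in>B. op p b = 0" "q \<noteq> 0" "op q b = 0"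
      using insert.IH ex_annihilating_poly_at[OF assms, of b] by blast
    then show ?case
      by (intro exI[of _ "p * q"]) (auto simp: op_mult, metis op_commute op_vector_0)
  qed
  then obtain p where p: "p \<noteq> 0" "\<forall>b\<in>Basis. op p b = 0"
    using finite_Basis by blast
  have "op p v = 0" for v
  proof -
    have "v \<in> span Basis"
      by (simp add: span_Basis)
    then show ?thesis
      using p(2) by (induction rule: span_induct_alt) (auto simp: op_vector_add op_vector_scale)
  qed
  with p(1) show ?thesis by blast
qed

text \<open>The commutator of \<open>h\<close> with \<open>p(e)\<close> is \<open>c e p'(e)\<close>. So if \<open>p\<close> is a polynomial of least degree \<open>d\<close> with
  \<open>p(e) = 0\<close>, then \<open>d p - X p'\<close> also annihilates \<open>e\<close> and has smaller degree. It is therefore zero, which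
  means that \<open>p\<close> is a multiple of \<open>X\<^sup>d\<close>.\<close>

lemma nilpotent_if_ad_eigenvector:
  fixes scale :: "'k::field_char_0 \<Rightarrow> 'v::ab_group_add \<Rightarrow> 'v" and e h :: "'v \<Rightarrow> 'v"
  assumes "finite_dimensional_vector_space scale basis"
    and e: "Vector_Spaces.linear scale scale e" and h: "Vector_Spaces.linear scale scale h"
    and eh: "\<And>v. h (e v) = e (h v) + scale c (e v)" and "c \<noteq> 0"
  shows "\<exists>k. \<forall>v. (e ^^ k) v = 0"
proof -
  interpret finite_dimensional_vector_space scale basis by fact
  interpret e: vector_space_operator scale e
    by (intro vector_space_operator.intro vector_space_operator_axioms.intro vector_space_axioms e)
  interpret h: vector_space_operator scale h
    by (intro vector_space_operator.intro vector_space_operator_axioms.intro vector_space_axioms h)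
  define ann where "ann = {p. p \<noteq> 0 \<and> (\<forall>v. e.op p v = 0)}"
  obtain p0 where "p0 \<in> ann"
    using ex_annihilating_poly[OF e] by (auto simp: ann_def)
  then obtain p where p: "p \<in> ann" and min: "\<And>q. q \<in> ann \<Longrightarrow> degree p \<le> degree q"
    using ex_has_least_nat[of "\<lambda>p. p \<in> ann" p0 degree] by blast
  have comm: "h (e.op q v) = e.op q (h v) + scale c (e (e.op (pderiv q) v))" for q v
    by (induction q)
      (simp_all add: e.op_pCons pderiv_pCons e.op_add eh h.T_add h.T_scale e.T_add e.T_scale
        algebra_simps)
  define q where "q = smult (of_nat (degree p)) p - pCons 0 (pderiv p)"
  have "e.op (pderiv p) (e v) = 0" for v
    using p comm[of p v] \<open>c \<noteq> 0\<close> by (simp add: ann_def e.T_op)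
  then have q0: "e.op q v = 0" for v
    using p by (simp add: ann_def q_def e.op_diff e.op_smult e.op_pCons e.T_op)
  have coeff_q: "coeff q i = (of_nat (degree p) - of_nat i) * coeff p i" for i
    by (cases i) (simp_all add: q_def coeff_pderiv algebra_simps)
  have "q = 0"
  proof (rule ccontr)
    assume "q \<noteq> 0"
    then have "degree p \<le> degree q"
      using q0 min by (simp add: ann_def)
    moreover have "coeff q (degree q) \<noteq> 0"
      using \<open>q \<noteq> 0\<close> by simp
    ultimately show False
      using coeff_q[of "degree q"] by (metis coeff_eq_0 diff_self le_neq_implies_less mult_zero_left mult_zero_right)
  qed
  have "coeff p i = 0" if "i \<noteq> degree p" for i
  proof (cases "i < degree p")
    case True
    then have "of_nat (degree p) - of_nat i = (of_nat (degree p - i) :: 'k)"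
      by (simp add: of_nat_diff)
    then show ?thesis
      using coeff_q[of i] \<open>q = 0\<close> True by simp
  next
    case False
    then show ?thesis using that by (simp add: coeff_eq_0)
  qed
  then have "p = monom (lead_coeff p) (degree p)"
    by (simp add: poly_eq_iff)
  then have "scale (lead_coeff p) ((e ^^ degree p) v) = 0" for v
    using p by (metis (mono_tags, lifting) ann_def e.op_monom mem_Collect_eq)
  then show ?thesis
    using p by (auto simp: ann_def)
qed

section \<open>Finite-dimensional representations of sl2\<close>

text \<open>The commutation relations are oriented as rewrite rules to the order \<open>f, e, h\<close>, and \<open>2 x\<close> is written \<open>x + x\<close>
  to keep them free of scalars.\<close>

locale sl2_representation = finite_dimensional_vector_space scale basis
  for scale :: "'k::field_char_0 \<Rightarrow> 'v::ab_group_add \<Rightarrow> 'v" and basis +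
  fixes e f h :: "'v \<Rightarrow> 'v"
  assumes linear_e: "Vector_Spaces.linear scale scale e"
    and linear_f: "Vector_Spaces.linear scale scale f"
    and linear_h: "Vector_Spaces.linear scale scale h"
    and ef: "e (f v) = f (e v) + h v"
    and he: "h (e v) = e (h v) + e v + e v"
    and hf: "h (f v) = f (h v) - f v - f v"
begin

interpretation e: vector_space_operator scale e
  by (intro vector_space_operator.intro vector_space_operator_axioms.intro vector_space_axioms linear_e)
interpretation f: vector_space_operator scale f
  by (intro vector_space_operator.intro vector_space_operator_axioms.intro vector_space_axioms linear_f)
interpretation h: vector_space_operator scale h
  by (intro vector_space_operator.intro vector_space_operator_axioms.intro vector_space_axioms linear_h)

lemmas op_simps = e.T_add f.T_add h.T_add e.T_diff f.T_diff h.T_diff e.T_scale f.T_scale h.T_scale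

text \<open>Exchanging \<open>e\<close> and \<open>f\<close> negates the weights, so a bound on the weights from one side gives one from the other.\<close>

lemma dual: "sl2_representation scale basis f e (\<lambda>v. - h v)"
proof (intro sl2_representation.intro sl2_representation_axioms.intro)
  show "Vector_Spaces.linear scale scale (\<lambda>v. - h v)"
    using linear_h by (simp add: Vector_Spaces.linear_iff)
qed (simp_all add: finite_dimensional_vector_space_axioms linear_e linear_f ef he hf
    e.T_diff[of 0, simplified] f.T_diff[of 0, simplified] op_simps)

lemma scale_2: "scale 2 v = v + v" and scale_4: "scale 4 v = v + v + v + v"
proof -
  show 2: "scale 2 v = v + v" for v
    using scale_left_distrib[of 1 1 v] by simp
  show "scale 4 v = v + v + v + v"
    using scale_left_distrib[of 2 2 v] by (simp add: 2 add_ac)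
qed

text \<open>Four times the Casimir operator \<open>f e + (h\<^sup>2 + 2 h) / 4\<close>.\<close>

definition casimir :: "'v \<Rightarrow> 'v" where
  "casimir v = f (e v) + f (e v) + f (e v) + f (e v) + h (h v) + h v + h v"

lemma linear_casimir: "Vector_Spaces.linear scale scale casimir"
  using vector_space_axioms
  by (simp add: Vector_Spaces.linear_iff casimir_def op_simps scale_right_distrib algebra_simps)

sublocale casimir: vector_space_operator scale casimir
  by (intro vector_space_operator.intro vector_space_operator_axioms.intro vector_space_axioms
      linear_casimir)

lemma casimir_e: "casimir (e v) = e (casimir v)"
  and casimir_f: "casimir (f v) = f (casimir v)"
  and casimir_h: "casimir (h v) = h (casimir v)"
  by (simp_all add: casimir_def op_simps ef he hf algebra_simps)

lemma h_e_power:
  "h.op [:a, 1:] ((e ^^ k) v) = (e ^^ k) (h.op [:a + of_nat (2 * k), 1:] v)"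
proof (induction k arbitrary: a)
  case (Suc k)
  have step: "h.op [:a, 1:] (e w) = e (h.op [:a + 2, 1:] w)" for w
    by (simp add: h.op_linear_factor he op_simps scale_left_distrib scale_2 add_ac)
  show ?case
    using Suc.IH[of "a + 2"] by (simp add: step add_ac)
qed simp

text \<open>On the kernel of the Casimir operator \<open>- 4 f e = h (h + 2)\<close>. Moving \<open>h\<close> past \<open>e\<^sup>k\<close> turns this into
  the factor \<open>(h + 2 k) (h + 2 k + 2)\<close>. The factor \<open>h\<close> occurs exactly once in the resulting product,
  which is what makes 0 a semisimple eigenvalue below.\<close>

lemma power_f_power_e_on_casimir_kernel:
  "\<exists>c ns. c \<noteq> 0 \<and> (\<forall>n\<in>set ns. n > 0) \<and>
     (\<forall>u. casimir u = 0 \<longrightarrow> scale c ((f ^^ Suc k) ((e ^^ Suc k) u)) =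
        h.op (\<Prod>a\<leftarrow>0 # map of_nat ns. [:a, 1:]) u)"
proof (induction k)
  have fe: "scale (- 4) (f (e v)) = h.op [:0, 1:] (h.op [:2, 1:] v)" if "casimir v = 0" for v
  proof -
    have "f (e v) + f (e v) + f (e v) + f (e v) + (h (h v) + h v + h v) = 0"
      using that by (simp add: casimir_def add_ac)
    then have "- scale 4 (f (e v)) = h (h v) + h v + h v"
      by (simp add: scale_4 add_eq_0_iff)
    then show ?thesis
      by (simp add: h.op_linear_factor op_simps scale_2 add_ac)
  qed
  {
    case 0
    show ?case
      by (intro exI[of _ "- 4"] exI[of _ "[2]"]) (auto simp: fe[simplified] h.op_pCons)
  next
    case (Suc k)
    then obtain c ns where c: "c \<noteq> 0" and ns: "\<forall>n\<in>set ns. n > 0"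
      and IH: "\<And>u. casimir u = 0 \<Longrightarrow> scale c ((f ^^ Suc k) ((e ^^ Suc k) u)) =
        h.op (\<Prod>a\<leftarrow>0 # map of_nat ns. [:a, 1:]) u"
      by blast
    have f_scale: "(f ^^ i) (scale d v) = scale d ((f ^^ i) v)" for i d v
      by (induction i) (simp_all add: op_simps)
    have casimir_e_power: "casimir ((e ^^ i) v) = (e ^^ i) (casimir v)" for i v
      by (induction i) (simp_all add: casimir_e)
    have e_power_0: "(e ^^ i) 0 = 0" for i
      by (induction i) simp_all
    have casimir_op: "casimir (h.op p v) = h.op p (casimir v)" for p v
      by (induction p) (simp_all add: h.op_pCons casimir.T_add casimir.T_scale casimir_h)
    let ?ns = "(2 * Suc k) # (2 + 2 * Suc k) # ns"
    have "scale (- 4 * c) ((f ^^ Suc (Suc k)) ((e ^^ Suc (Suc k)) u)) =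
        h.op (\<Prod>a\<leftarrow>0 # map of_nat ?ns. [:a, 1:]) u" if u: "casimir u = 0" for u
    proof -
      \<comment> \<open>The two factors that appear when \<open>h\<close> and \<open>h + 2\<close> move past \<open>e\<^sup>k\<^sup>+\<^sup>1\<close>.\<close>
      define u' where "u' = h.op [:of_nat (2 * Suc k), 1:] (h.op [:of_nat (2 + 2 * Suc k), 1:] u)"
      have "scale (- 4 * c) ((f ^^ Suc (Suc k)) ((e ^^ Suc (Suc k)) u)) =
          scale c ((f ^^ Suc k) (scale (- 4) (f (e ((e ^^ Suc k) u)))))"
        by (simp only: funpow_Suc_right[of "Suc k" f] funpow.simps(2)[of "Suc k" e] o_apply
            f_scale scale_scale mult.commute[of c])
      also have "\<dots> = scale c ((f ^^ Suc k) (h.op [:0, 1:] (h.op [:2, 1:] ((e ^^ Suc k) u))))"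
        using u by (subst fe) (simp_all only: casimir_e_power e_power_0)
      also have "\<dots> = scale c ((f ^^ Suc k) ((e ^^ Suc k) u'))"
        by (simp only: h_e_power u'_def of_nat_add of_nat_numeral add_0)
      also have "\<dots> = h.op (\<Prod>a\<leftarrow>0 # map of_nat ns. [:a, 1:]) u'"
        by (rule IH) (simp add: u'_def casimir_op u)
      also have "\<dots> = h.op (\<Prod>a\<leftarrow>0 # map of_nat ?ns. [:a, 1:]) u"
        unfolding u'_def h.op_mult[symmetric] by (simp only: list.map prod_list.Cons mult_ac)
      finally show ?thesis .
    qed
    then show ?case
      using c ns by (intro exI[of _ "- 4 * c"] exI[of _ ?ns]) auto
  }
qed

lemma e_nilpotent: "\<exists>k. \<forall>v. (e ^^ k) v = 0"
proof -
  have he2: "h (e v) = e (h v) + scale 2 (e v)" for v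
    by (simp add: he scale_2 add_ac)
  show ?thesis
    using nilpotent_if_ad_eigenvector[of scale basis e h 2]
      finite_dimensional_vector_space_axioms linear_e linear_h he2 by simp
qed

text \<open>Since \<open>e\<close> is nilpotent, the left-hand side of \<open>power_f_power_e_on_casimir_kernel\<close> vanishes for large \<open>k\<close>.\<close>

lemma ex_positive_weights:
  "\<exists>ns. (\<forall>n\<in>set ns. n > 0) \<and>
     (\<forall>u. casimir u = 0 \<longrightarrow> h.op (\<Prod>a\<leftarrow>0 # map of_nat ns. [:a, 1:]) u = 0)"
proof -
  obtain k where k: "(e ^^ k) v = 0" for v
    using e_nilpotent by blast
  have "(f ^^ i) 0 = 0" for i
    by (induction i) simp_all
  then have "(f ^^ Suc k) ((e ^^ Suc k) u) = 0" for u
    using k by (simp add: funpow_swap1)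
  then show ?thesis
    using power_f_power_e_on_casimir_kernel[of k] by (metis scale_zero_right)
qed

lemma weight_on_casimir_kernel:
  assumes "casimir u = 0" "u \<noteq> 0" "h u = scale c u"
  shows "\<exists>n. c = - of_nat n"
proof -
  obtain ns :: "nat list" where "h.op (\<Prod>a\<leftarrow>0 # map of_nat ns. [:a, 1:]) u = 0"
    using ex_positive_weights assms(1) by blast
  then have "poly (\<Prod>a\<leftarrow>0 # map of_nat ns. [:a, 1:]) c = 0"
    using assms h.op_eigenvector by simp
  moreover have "\<exists>a\<in>set as. a + c = 0" if "poly (\<Prod>a\<leftarrow>as. [:a, 1:]) c = 0" for as
    using that by (induction as) (auto simp flip: distrib_right)
  ultimately have "\<exists>a\<in>set (0 # map of_nat ns). a + c = 0"
    by blast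
  then have "\<exists>n. of_nat n + c = 0"
    by auto
  then show ?thesis
    by (metis add_eq_0_iff)
qed

text \<open>By \<open>weight_on_casimir_kernel\<close> for the representation and for its dual, 0 is the only eigenvalue of \<open>h\<close> on
  the kernel. If \<open>h u\<close> were nonzero, then, because \<open>h\<close> is a simple factor of the annihilating polynomial of
  \<open>u\<close>, the remaining factors would annihilate \<open>h u\<close> and produce a nonzero eigenvalue.\<close>

lemma h_eq_0_on_casimir_kernel:
  assumes "casimir u = 0"
  shows "h u = 0"
proof (rule ccontr)
  assume "h u \<noteq> 0"
  interpret dual: sl2_representation scale basis f e "\<lambda>v. - h v"
    by (fact dual)
  have casimir_dual: "dual.casimir v = casimir v" for v
    by (simp add: dual.casimir_def casimir_def ef h.T_diff[of 0, simplified])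
  obtain ns :: "nat list" where pos: "\<forall>n\<in>set ns. n > 0"
    and "h.op (\<Prod>a\<leftarrow>0 # map of_nat ns. [:a, 1:]) u = 0"
    using ex_positive_weights assms by blast
  then have "h.op (\<Prod>a\<leftarrow>map of_nat ns. [:a, 1:]) (h u) = 0"
    by (simp add: h.op_mult h.op_pCons h.T_op)
  moreover have "subspace {v. casimir v = 0}" 
    by (simp add: subspace_def casimir.T_add casimir.T_scale)
  moreover have "h u \<in> {v. casimir v = 0}"
    using assms by (simp add: casimir_h)
  ultimately obtain n v where n: "n \<in> set ns" and v: "casimir v = 0" "v \<noteq> 0"
      "h v = scale (- of_nat n) v"
    using h.eigenvector_if_split_annihilator[of "{v. casimir v = 0}" "h u" "map of_nat ns"]
      \<open>h u \<noteq> 0\<close> by (auto simp: casimir_h)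
  have "\<exists>m. (of_nat n :: 'k) = - of_nat m"
    using v by (intro dual.weight_on_casimir_kernel[of v]) (simp_all add: casimir_dual)
  then obtain m where "of_nat (n + m) = (0 :: 'k)"
    by (auto simp: of_nat_add eq_neg_iff_add_eq_0)
  then show False
    using n pos by (simp only: of_nat_eq_0_iff) auto
qed

lemma e_eq_0_on_casimir_kernel:
  assumes "casimir u = 0"
  shows "e u = 0"
proof -
  have "h (e u) = 0" "h u = 0"
    using assms h_eq_0_on_casimir_kernel by (simp_all add: casimir_e)
  then have "scale 2 (e u) = 0"
    using he[of u] by (simp add: scale_2)
  then show ?thesis by simp
qed

lemma f_eq_0_on_casimir_kernel:
  assumes "casimir u = 0"
  shows "f u = 0"
proof -
  have "h (f u) = 0" "h u = 0"
    using assms h_eq_0_on_casimir_kernel by (simp_all add: casimir_f)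
  then have "scale 2 (f u) = 0"
    using hf[of u] by (metis scale_2 add.inverse_neutral diff_0 f.T_0 minus_add_distrib minus_minus
        uminus_add_conv_diff)
  then show ?thesis by simp
qed

text \<open>The vector \<open>casimir v\<close> is invariant, so \<open>e v\<close> and \<open>f v\<close> lie in the kernel of the Casimir operator and are
  invariant too. Hence \<open>h v = e f v - f e v\<close> and \<open>casimir v\<close> vanish.\<close>

lemma casimir_kernel_stable:
  assumes "casimir (casimir v) = 0"
  shows "casimir v = 0"
proof -
  have "casimir (e v) = 0" "casimir (f v) = 0"
    using assms e_eq_0_on_casimir_kernel f_eq_0_on_casimir_kernel
    by (simp_all add: casimir_e casimir_f)
  then have "f (e v) = 0" "e (f v) = 0"
    using e_eq_0_on_casimir_kernel f_eq_0_on_casimir_kernel by simp_all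
  then have "h v = 0"
    by (metis ef add_0)
  then show ?thesis
    using \<open>f (e v) = 0\<close> by (simp add: casimir_def)
qed

text \<open>The Fitting decomposition of the Casimir operator, whose generalized kernel is its kernel.\<close>

theorem invariant_plus_casimir_image:
  "\<exists>v. e (w - casimir v) = 0 \<and> f (w - casimir v) = 0 \<and> h (w - casimir v) = 0"
proof -
  obtain p where p: "p \<noteq> 0" "\<And>v. casimir.op p v = 0"
    using ex_annihilating_poly[OF linear_casimir] by blast
  obtain m q where pq: "p = [:0, 1:] ^ m * q" and "poly q 0 \<noteq> 0"
    using order_decomp[OF p(1), of 0] by (auto simp: poly_eq_0_iff_dvd)
  have stable: "casimir v = 0" if "casimir.op ([:0, 1:] ^ Suc n) v = 0" for n v
    using that
  proof (induction n)
    case 0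
    then show ?case by (simp add: casimir.op_pCons)
  next
    case (Suc n)
    then have "casimir (casimir (casimir.op ([:0, 1:] ^ n) v)) = 0"
      by (simp add: casimir.op_pCons)
    then have "casimir (casimir.op ([:0, 1:] ^ n) v) = 0"
      by (rule casimir_kernel_stable)
    then show ?case
      using Suc.IH by (simp add: casimir.op_pCons)
  qed
  obtain c r where q: "q = pCons c r" and c: "c \<noteq> 0"
    using \<open>poly q 0 \<noteq> 0\<close> by (cases q) auto
  have "casimir.op ([:0, 1:] ^ Suc m) (casimir.op q w) = casimir (casimir.op p w)"
    by (simp add: pq casimir.op_mult casimir.op_pCons)
  then have "casimir (casimir.op q w) = 0"
    using stable p(2) casimir.T_0 by metis
  then have *: "casimir (scale (inverse c) (casimir.op q w)) = 0"
    by (simp add: casimir.T_scale)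
  have "scale (inverse c) (casimir.op q w) = w - casimir (- scale (inverse c) (casimir.op r w))"
    using c casimir.T_diff[of 0] by (simp add: q casimir.op_pCons scale_right_distrib casimir.T_scale)
  then show ?thesis
    using * e_eq_0_on_casimir_kernel f_eq_0_on_casimir_kernel h_eq_0_on_casimir_kernel by metis
qed

end

section \<open>Whitehead's lemma modulo a subspace\<close>

text \<open>On \<open>U1\<close> the map \<open>P\<close> stands for the projection to \<open>U1 / U0\<close>: its image is a complement of \<open>U0\<close> in \<open>U1\<close>,
  so the quotient is modelled inside the same vector space.\<close>

lemma (in vector_space) ex_projection_onto_complement:
  assumes "subspace U0" "subspace U1" "U0 \<subseteq> U1"
  shows "\<exists>P. Vector_Spaces.linear scale scale P \<and> (\<forall>u\<in>U0. P u = 0) \<and>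
    (\<forall>u\<in>U1. u - P u \<in> U0) \<and> (\<forall>v. P v \<in> U1)"
proof -
  interpret vector_space_pair scale scale by unfold_locales
  obtain B0 where B0: "B0 \<subseteq> U0" "independent B0" "U0 \<subseteq> span B0"
    by (rule maximal_independent_subset)
  obtain B1 where B1: "B0 \<subseteq> B1" "B1 \<subseteq> U1" "independent B1" "U1 \<subseteq> span B1"
    by (rule maximal_independent_subset_extend[of B0 U1]) (use B0 assms(3) in auto)
  obtain B where B: "B1 \<subseteq> B" "independent B" "UNIV \<subseteq> span B"
    by (rule maximal_independent_subset_extend[of B1 UNIV]) (use B1 in auto)
  obtain P where P: "Vector_Spaces.linear scale scale P"
    and P_basis: "\<And>b. b \<in> B \<Longrightarrow> P b = (if b \<in> B1 - B0 then b else 0)"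
    using linear_independent_extend[OF B(2), of "\<lambda>b. if b \<in> B1 - B0 then b else 0"] by auto
  interpret P: Vector_Spaces.linear scale scale P by (fact P)
  have P_basis_U1: "P b \<in> U1" if "b \<in> B" for b
    using that P_basis B1(2) assms(2) by (simp add: subspace_0 subset_iff)
  have P_basis_B0: "P b = 0" if "b \<in> B0" for b
  proof -
    have "b \<in> B" using that B0(1) B1(1) B(1) by blast
    then show ?thesis using that by (simp add: P_basis)
  qed
  have P_basis_B1: "b - P b \<in> U0" if "b \<in> B1" for b
  proof (cases "b \<in> B0")
    case True
    then show ?thesis using P_basis_B0 B0(1) by auto
  next
    case False
    have "b \<in> B" using that B(1) by blast
    then show ?thesis using that False assms(1) by (simp add: P_basis subspace_0)
  qed
  have "P u = 0" if "u \<in> U0" for u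
  proof -
    have "u \<in> span B0" using that B0(3) by blast
    then show ?thesis using P_basis_B0 by (rule P.eq_0_on_span[rotated])
  qed
  moreover have "P v \<in> U1" for v
  proof -
    have "v \<in> span B" using B(3) by blast
    then show ?thesis
    proof (induction rule: span_induct_alt)
      case base
      show ?case using assms(2) by (simp add: P.zero subspace_0)
    next
      case (step c b v)
      then show ?case
        using P_basis_U1 assms(2) by (simp add: P.add P.scale subspace_add subspace_scale)
    qed
  qed
  moreover have "u - P u \<in> U0" if "u \<in> U1" for u
  proof -
    have "u \<in> span B1" using that B1(4) by blast
    then show ?thesis
    proof (induction rule: span_induct_alt)
      case base
      show ?case using assms(1) by (simp add: P.zero subspace_0)
    next
      case (step c b v)
      have "scale c b + v - P (scale c b + v) = scale c (b - P b) + (v - P v)"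
        by (simp add: P.add P.scale algebra_simps)
      then show ?case
        using step P_basis_B1 assms(1) by (simp only: subspace_add subspace_scale)
    qed
  qed
  ultimately show ?thesis
    using P by (intro exI[of _ P]) simp
qed

context sl2_representation
begin

text \<open>Whitehead's first lemma for the quotient module \<open>U1 / U0\<close>: a cocycle with values \<open>ce\<close>, \<open>cf\<close>, \<open>ch\<close> is a
  coboundary. The cocycle defines an extension of \<open>U1 / U0\<close> by the trivial module. An invariant of the extension
  that differs from \<open>(0, 1)\<close> by an element of the image of the Casimir operator has the form \<open>(v, 1)\<close>, and
  the invariance of \<open>(v, 1)\<close> says that \<open>v\<close> trivializes the cocycle.\<close>

theorem ex_trivializing_vector_mod_subspace:
  assumes "subspace U0" "subspace U1" "U0 \<subseteq> U1"
    and inv0: "\<And>u. u \<in> U0 \<Longrightarrow> e u \<in> U0" "\<And>u. u \<in> U0 \<Longrightarrow> f u \<in> U0" "\<And>u. u \<in> U0 \<Longrightarrow> h u \<in> U0"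
    and inv1: "\<And>u. u \<in> U1 \<Longrightarrow> e u \<in> U1" "\<And>u. u \<in> U1 \<Longrightarrow> f u \<in> U1" "\<And>u. u \<in> U1 \<Longrightarrow> h u \<in> U1"
    and c: "ce \<in> U1" "cf \<in> U1" "ch \<in> U1"
    and cocycle: "e cf - f ce - ch \<in> U0" "h ce - e ch - (ce + ce) \<in> U0"
      "h cf - f ch + (cf + cf) \<in> U0"
  shows "\<exists>y\<in>U1. ce + e y \<in> U0 \<and> cf + f y \<in> U0 \<and> ch + h y \<in> U0"
proof -
  interpret e: Vector_Spaces.linear scale scale e by (fact linear_e)
  interpret f: Vector_Spaces.linear scale scale f by (fact linear_f)
  interpret h: Vector_Spaces.linear scale scale h by (fact linear_h)
  obtain P where P: "Vector_Spaces.linear scale scale P" and P0: "\<And>u. u \<in> U0 \<Longrightarrow> P u = 0"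
    and P_mod: "\<And>u. u \<in> U1 \<Longrightarrow> u - P u \<in> U0" and P1 [simp]: "\<And>v. P v \<in> U1"
    using ex_projection_onto_complement[OF assms(1-3)] by blast
  interpret P: Vector_Spaces.linear scale scale P by (fact P)
  have P_PP: "P (e (P u)) = P (e u)" "P (f (P u)) = P (f u)" "P (h (P u)) = P (h u)"
    if "u \<in> U1" for u
    using P0[OF inv0(1)[OF P_mod[OF that]]] P0[OF inv0(2)[OF P_mod[OF that]]]
      P0[OF inv0(3)[OF P_mod[OF that]]]
    by (simp_all add: e.diff f.diff h.diff P.diff)
  have Pc: "P (e cf) = P (f ce) + P ch" "P (h ce) = P (e ch) + P ce + P ce"
      "P (h cf) = P (f ch) - P cf - P cf"
    using cocycle[THEN P0] unfolding P.diff P.add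
    by (simp_all only: diff_diff_add diff_add_eq right_minus_eq add.assoc)
       (simp_all add: eq_diff_eq add_ac flip: eq_neg_iff_add_eq_0)
  interpret K: finite_dimensional_vector_space "(*) :: 'k \<Rightarrow> 'k \<Rightarrow> 'k" "{1}"
    by (fact vector_space_over_itself.finite_dimensional_vector_space_axioms)
  interpret VK: finite_dimensional_vector_space_prod scale "(*) :: 'k \<Rightarrow> 'k \<Rightarrow> 'k" basis "{1}"
    by unfold_locales
  \<comment> \<open>The action on the extension: \<open>P x P\<close> models the action of \<open>x\<close> on \<open>U1 / U0\<close>, and \<open>c\<close> is the value of the cocycle.\<close>
  define lift where "lift x c vt = (P (x (P (fst vt))) + scale (snd vt) (P c), 0 :: 'k)"
    for x :: "'v \<Rightarrow> 'v" and c and vt :: "'v \<times> 'k"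
  have linear_lift: "Vector_Spaces.linear VK.scale VK.scale (lift x c)"
    if "Vector_Spaces.linear scale scale x" for x c
  proof -
    interpret x: Vector_Spaces.linear scale scale x by (fact that)
    show ?thesis
      using VK.p.vector_space_axioms
      by (simp add: Vector_Spaces.linear_iff lift_def VK.scale_def P.add P.scale x.add x.scale
          scale_right_distrib scale_left_distrib)
  qed
  interpret ext: sl2_representation VK.scale VK.Basis_pair "lift e ce" "lift f cf" "lift h ch"
  proof (intro sl2_representation.intro sl2_representation_axioms.intro
      VK.p.finite_dimensional_vector_space_axioms)
    show "Vector_Spaces.linear VK.scale VK.scale (lift e ce)"
      "Vector_Spaces.linear VK.scale VK.scale (lift f cf)"
      "Vector_Spaces.linear VK.scale VK.scale (lift h ch)"
      by (simp_all only: linear_lift linear_e linear_f linear_h)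
  fix w :: "'v \<times> 'k"
    note simps = lift_def P.add P.diff P.scale e.add f.add h.add e.scale f.scale h.scale
      P_PP inv1 c Pc
    show "lift e ce (lift f cf w) = lift f cf (lift e ce w) + lift h ch w"
      by (simp add: simps ef scale_right_distrib)
    show "lift h ch (lift e ce w) = lift e ce (lift h ch w) + lift e ce w + lift e ce w"
      by (simp add: simps he scale_right_distrib)
    show "lift h ch (lift f cf w) = lift f cf (lift h ch w) - lift f cf w - lift f cf w"
      by (simp add: simps hf scale_right_diff_distrib)
  qed
  obtain v where v: "lift e ce ((0, 1) - ext.casimir v) = 0" "lift f cf ((0, 1) - ext.casimir v) = 0"
      "lift h ch ((0, 1) - ext.casimir v) = 0"
    using ext.invariant_plus_casimir_image[of "(0, 1)"] by blast
  define y where "y = P (- fst (ext.casimir v))"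
  have "snd (ext.casimir v) = 0"
    by (simp add: ext.casimir_def lift_def)
  then have Py: "P (ce + e y) = 0" "P (cf + f y) = 0" "P (ch + h y) = 0"
    using v by (simp_all add: lift_def y_def P.add zero_prod_def add.commute)
  have "y \<in> U1"
    by (simp add: y_def)
  then have "ce + e y \<in> U1" "cf + f y \<in> U1" "ch + h y \<in> U1"
    using c inv1 assms(2) by (simp_all add: subspace_add)
  from this[THEN P_mod] \<open>y \<in> U1\<close> show ?thesis
    unfolding Py by auto
qed

end

section \<open>Determinants, traces and derivatives of curves\<close>

lemma det_has_field_derivative:
  fixes A :: "'k::real_normed_field \<Rightarrow> 'k^'n^'n"
  assumes "\<And>i j. ((\<lambda>t. A t $ i $ j) has_field_derivative A' $ i $ j) (at t)"
  shows "((\<lambda>t. det (A t)) has_field_derivative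
    (\<Sum>i\<in>UNIV. det (\<chi> k. if k = i then A' $ i else A t $ k))) (at t)"
proof -
  let ?S = "{p. p permutes (UNIV :: 'n set)}"
  have row: "(\<Prod>k\<in>UNIV. (\<chi> k. if k = i then A' $ i else A t $ k) $ k $ p k)
      = A' $ i $ p i * (\<Prod>k\<in>UNIV - {i}. A t $ k $ p k)" for p i
    by (subst prod.remove[of _ i]) (auto intro!: prod.cong)
  have "((\<lambda>t. \<Sum>p\<in>?S. of_int (sign p) * (\<Prod>i\<in>UNIV. A t $ i $ p i)) has_field_derivative
      (\<Sum>p\<in>?S. of_int (sign p) * (\<Sum>i\<in>UNIV. A' $ i $ p i * (\<Prod>k\<in>UNIV - {i}. A t $ k $ p k))))
      (at t)"
    by (intro DERIV_sum DERIV_cmult has_field_derivative_prod assms)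
  also have "(\<Sum>p\<in>?S. of_int (sign p) *
        (\<Sum>i\<in>UNIV. A' $ i $ p i * (\<Prod>k\<in>UNIV - {i}. A t $ k $ p k)))
      = (\<Sum>i\<in>UNIV. det (\<chi> k. if k = i then A' $ i else A t $ k))"
    unfolding det_def row sum_distrib_left by (rule sum.swap)
  finally show ?thesis
    by (simp add: det_def)
qed

text \<open>Row \<open>i\<close> of \<open>K ** A\<close> is a combination of the rows of \<open>A\<close>, of which only the multiple of row \<open>i\<close> itself
  contributes. With \<open>det_has_field_derivative\<close> this is Jacobi's formula for a curve with \<open>A' = K ** A\<close>.\<close>

lemma sum_det_replace_row_matrix_mult:
  fixes A K :: "'k::comm_ring_1^'n^'n"
  shows "(\<Sum>i\<in>UNIV. det (\<chi> k. if k = i then (K ** A) $ i else A $ k)) = trace K * det A"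
proof -
  have "det (\<chi> k. if k = i then (K ** A) $ i else A $ k) = K $ i $ i * det A" for i
  proof -
    have row: "(K ** A) $ i = (\<Sum>j\<in>UNIV. K $ i $ j *s A $ j)"
      by (simp add: vec_eq_iff matrix_matrix_mult_def)
    have "det (\<chi> k. if k = i then (K ** A) $ i else A $ k)
        = (\<Sum>j\<in>UNIV. K $ i $ j * det (\<chi> k. if k = i then A $ j else A $ k))"
      unfolding row by (subst det_linear_row_sum) (simp_all add: det_row_mul)
    also have "\<dots> = (\<Sum>j\<in>UNIV. if j = i then K $ i $ i * det A else 0)"
    proof (rule sum.cong)
      fix j
      have "(\<chi> k. if k = i then A $ i else A $ k) = A"
        by (simp add: vec_eq_iff)
      moreover have "det (\<chi> k. if k = i then A $ j else A $ k) = 0" if "j \<noteq> i"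
        by (rule det_identical_rows[of i j]) (use that in \<open>auto simp: row_def vec_eq_iff\<close>)
      ultimately show "K $ i $ j * det (\<chi> k. if k = i then A $ j else A $ k)
          = (if j = i then K $ i $ i * det A else 0)"
        by auto
    qed simp
    finally show ?thesis by simp
  qed
  then show ?thesis
    by (simp add: trace_def sum_distrib_right)
qed

lemma trace_matrix_commutator:
  fixes f g :: "complex^'n \<Rightarrow> complex^'n"
  assumes "Vector_Spaces.linear (*s) (*s) f" "Vector_Spaces.linear (*s) (*s) g"
  shows "trace (matrix (\<lambda>v. f (g v) - g (f v))) = 0"
proof -
  have "matrix (\<lambda>v. f (g v) - g (f v)) = matrix f ** matrix g - matrix g ** matrix f"
    using assms by (simp add: matrix_compose_gen[symmetric]) (simp add: matrix_def vec_eq_iff)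
  then show ?thesis
    by (simp add: trace_sub trace_mul_sym[of "matrix f"])
qed

text \<open>The trace of \<open>L\<close> is a linear functional that vanishes on all brackets.\<close>

lemma trace_representation_of_perfect_eq_0:
  fixes br :: "complex^'n \<Rightarrow> complex^'n \<Rightarrow> complex^'n" and L :: "complex^'n \<Rightarrow> complex^'n \<Rightarrow> complex^'n"
  assumes perfect: "vec.span {br x y |x y. True} = UNIV"
    and L: "\<And>x. Vector_Spaces.linear (*s) (*s) (L x)"
      "\<And>v. Vector_Spaces.linear (*s) (*s) (\<lambda>x. L x v)"
      "\<And>x y v. L (br x y) v = L x (L y v) - L y (L x v)"
  shows "trace (matrix (L x)) = 0"
proof -
  have "x \<in> vec.span {br x y |x y. True}"
    using perfect by blast
  then show ?thesis
  proof (induction rule: vec.span_induct_alt)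
    case base
    have "L 0 v = 0" for v
      using vec.linear_0[OF L(2)] .
    then show ?case by (simp add: trace_def matrix_def)
  next
    case (step c b w)
    then obtain y z where b: "b = br y z" by blast
    have "trace (matrix (L (br y z))) = 0"
      using trace_matrix_commutator[OF L(1) L(1), of y z] by (simp add: L(3)[abs_def])
    moreover have "L (c *s b + w) v = c *s L b v + L w v" for v
      using vec.linear_add[OF L(2)] vec.linear_scale[OF L(2)] by simp
    ultimately show ?case
      using step(2) by (simp add: b trace_def matrix_def sum.distrib flip: sum_distrib_left)
  qed
qed

text \<open>Coordinatewise, because the parameter is complex, while the normed space \<open>complex^'n\<close> has real scalars.\<close>

definition has_coordinate_derivative ::
  "(complex \<Rightarrow> complex^'n) \<Rightarrow> complex^'n \<Rightarrow> complex \<Rightarrow> bool" where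
  "has_coordinate_derivative u u' t \<longleftrightarrow>
     (\<forall>i. ((\<lambda>s. u s $ i) has_field_derivative u' $ i) (at t))"

lemma has_coordinate_derivative_add:
  "has_coordinate_derivative u u' t \<Longrightarrow> has_coordinate_derivative v v' t \<Longrightarrow>
   has_coordinate_derivative (\<lambda>s. u s + v s) (u' + v') t"
  by (auto simp: has_coordinate_derivative_def intro!: DERIV_add)

lemma has_coordinate_derivative_diff:
  "has_coordinate_derivative u u' t \<Longrightarrow> has_coordinate_derivative v v' t \<Longrightarrow>
   has_coordinate_derivative (\<lambda>s. u s - v s) (u' - v') t"
  by (auto simp: has_coordinate_derivative_def intro!: DERIV_diff)

lemma has_coordinate_derivative_linear:
  fixes f :: "complex^'n \<Rightarrow> complex^'m"
  assumes "Vector_Spaces.linear (*s) (*s) f" "has_coordinate_derivative u u' t"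
  shows "has_coordinate_derivative (\<lambda>s. f (u s)) (f u') t"
proof -
  have f: "f v $ i = (\<Sum>j\<in>UNIV. matrix f $ i $ j * v $ j)" for v i
    using matrix_works[OF assms(1), of v] by (simp add: matrix_vector_mult_def vec_eq_iff)
  show ?thesis
    using assms(2) unfolding has_coordinate_derivative_def f
    by (auto intro!: DERIV_sum DERIV_cmult)
qed

lemma has_coordinate_derivative_bilinear:
  fixes B :: "complex^'n \<Rightarrow> complex^'n \<Rightarrow> complex^'n"
  assumes B: "\<And>x. Vector_Spaces.linear (*s) (*s) (B x)"
      "\<And>y. Vector_Spaces.linear (*s) (*s) (\<lambda>x. B x y)"
    and "has_coordinate_derivative u u' t" "has_coordinate_derivative v v' t"
  shows "has_coordinate_derivative (\<lambda>s. B (u s) (v s)) (B u' (v t) + B (u t) v') t"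
proof -
  have expand: "B x y $ i = (\<Sum>a\<in>UNIV. x $ a * B (axis a 1) y $ i)" for x y i
  proof -
    have "B x y = B (\<Sum>a\<in>UNIV. x $ a *s axis a 1) y"
      by (simp add: basis_expansion)
    then show ?thesis
      by (simp add: vec.linear_sum[OF B(2)] vec.linear_scale[OF B(2)])
  qed
  have "has_coordinate_derivative (\<lambda>s. B (axis a 1) (v s)) (B (axis a 1) v') t" for a
    using B(1) assms(4) by (rule has_coordinate_derivative_linear)
  then show ?thesis
    using assms(3) unfolding has_coordinate_derivative_def vector_add_component
      expand[of u'] expand[of "u _"] sum.distrib[symmetric]
    by (auto intro!: DERIV_sum derivative_eq_intros)
qed

lemma eq_if_derivative_0:
  fixes g :: "'k::real_normed_field \<Rightarrow> 'k"
  assumes "\<And>t. (g has_field_derivative 0) (at t)"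
  shows "g s = g t"
  using has_field_derivative_zero_constant[of UNIV g] assms by auto

text \<open>Uniqueness for the linear equation \<open>u' = N u\<close>: by descending induction on \<open>j\<close>, the derivative of \<open>N\<^sup>j u\<close> is
  \<open>N\<^sup>j\<^sup>+\<^sup>1 u = 0\<close>.\<close>

lemma eq_0_if_derivative_nilpotent:
  fixes u :: "complex \<Rightarrow> complex^'n" and N :: "complex^'n \<Rightarrow> complex^'n"
  assumes N: "Vector_Spaces.linear (*s) (*s) N" "\<And>v. (N ^^ k) v = 0"
    and u: "u 0 = 0" "\<And>t. has_coordinate_derivative u (N (u t)) t"
  shows "u t = 0"
proof -
  have linear_power: "Vector_Spaces.linear (*s) (*s) (N ^^ j)" for j
  proof (induction j)
    case 0
    show ?case using vec.linear_id by (simp add: id_def)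
  next
    case (Suc j)
    show ?case using Vector_Spaces.linear_compose[OF Suc N(1)] by (simp add: o_def)
  qed
  have "\<forall>t. (N ^^ j) (u t) = 0" if "j \<le> k" for j
    using that
  proof (induction rule: inc_induct)
    case base
    show ?case using N(2) by simp
  next
    case (step j)
    have "has_coordinate_derivative (\<lambda>t. (N ^^ j) (u t)) ((N ^^ j) (N (u t))) t" for t
      using linear_power u(2) by (rule has_coordinate_derivative_linear)
    moreover have "(N ^^ j) (N (u t)) = 0" for t
      using step.IH by (simp add: funpow_swap1)
    ultimately have "((\<lambda>t. (N ^^ j) (u t) $ i) has_field_derivative 0) (at t)" for t i
      by (simp add: has_coordinate_derivative_def)
    then have "(N ^^ j) (u t) $ i = (N ^^ j) (u 0) $ i" for t i
      by (rule eq_if_derivative_0)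
    then show ?case
      using vec.linear_0[OF linear_power, of j] u(1) by (simp add: vec_eq_iff)
  qed
  from this[of 0] show ?thesis by simp
qed

section \<open>The lower central series\<close>

context lie_algebra
begin

lemmas br_simps_right = Vector_Spaces.linear_iff[THEN iffD1, OF br_linear_right]
  and br_simps_left = Vector_Spaces.linear_iff[THEN iffD1, OF br_linear_left]

lemma br_add_right: "br x (y + z) = br x y + br x z"
  and br_scale_right: "br x (sc c y) = sc c (br x y)"
  and br_add_left: "br (x + y) z = br x z + br y z"
  and br_scale_left: "br (sc c x) z = sc c (br x z)"
  using br_simps_right br_simps_left by blast+

lemma br_diff_right: "br x (y - z) = br x y - br x z"
  and br_diff_left: "br (x - y) z = br x z - br y z"
  using br_add_right[of x "y - z" z] br_add_left[of "x - y" y z] by simp_all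

lemma br_minus_right: "br x (- y) = - br x y"
  using br_scale_right[of x "- 1" y] by simp

lemma br_antisym: "br x y = - br y x"
proof -
  have "br (x + y) (x + y) = br x y + br y x"
    by (simp add: br_add_left br_add_right br_alternating[of x] br_alternating[of y])
  then show ?thesis
    using br_alternating[of "x + y"] by (simp add: eq_neg_iff_add_eq_0)
qed

lemma ad_derivation: "br x (br y z) = br (br x y) z + br y (br x z)"
proof -
  have "br x (br y z) + - br y (br x z) + - br (br x y) z = 0"
    using jacobi[of x y z] by (simp only: br_antisym[of z] br_minus_right)
  then show ?thesis
    by (metis add.commute add.assoc add_uminus_conv_diff eq_iff_diff_eq_0 diff_diff_add)
qed

lemma subspace_lower_central: "subspace (lower_central k)"
  by (cases k) auto

lemma br_in_lower_central:
  assumes "y \<in> lower_central k"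
  shows "br x y \<in> lower_central (Suc k)" "br y x \<in> lower_central (Suc k)"
proof -
  show 1: "br x y \<in> lower_central (Suc k)"
    using assms by (auto intro!: span_base)
  show "br y x \<in> lower_central (Suc k)"
    using subspace_neg[OF subspace_lower_central 1] br_antisym[of y x] by simp
qed

lemma lower_central_Suc_subset: "lower_central (Suc k) \<subseteq> lower_central k"
proof (induction k)
  case (Suc k)
  show ?case
    by (subst (1 2) lower_central.simps(2)) (use Suc in \<open>intro span_mono; blast\<close>)
qed simp

lemma derivation_lower_central:
  assumes D: "Vector_Spaces.linear sc sc D" "\<And>x y. D (br x y) = br (D x) y + br x (D y)"
    and "v \<in> lower_central k"
  shows "D v \<in> lower_central k"
  using assms(3)
proof (induction k arbitrary: v)
  case (Suc k)
  interpret D: Vector_Spaces.linear sc sc D by (fact D(1))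
  from Suc.prems have "v \<in> span {br x y | x y. y \<in> lower_central k}"
    by simp
  then show ?case
  proof (induction rule: span_induct_alt)
    case base
    show ?case by (simp add: D.zero subspace_0[OF subspace_lower_central] del: lower_central.simps)
  next
    case (step c b w)
    then obtain x y where "b = br x y" "y \<in> lower_central k" by blast
    then have "D b \<in> lower_central (Suc k)"
      using Suc.IH br_in_lower_central subspace_add[OF subspace_lower_central]
      by (simp add: D(2) del: lower_central.simps)
    then show ?case
      using step(2) subspace_add[OF subspace_lower_central] subspace_scale[OF subspace_lower_central]
      by (simp add: D.add D.scale del: lower_central.simps)
  qed
qed simp

lemma ad_power_in_lower_central: "(br y ^^ k) v \<in> lower_central k"
  by (induction k) (auto simp: br_in_lower_central simp del: lower_central.simps(2))

end

section \<open>Crossed homomorphisms and the change of base point\<close>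

locale post_lie_pair = g: lie_algebra "(*s)" brg + n: lie_algebra "(*s)" brn
  for brg brn :: "complex^'n \<Rightarrow> complex^'n \<Rightarrow> complex^'n" +
  fixes p :: "complex^'n \<Rightarrow> complex^'n \<Rightarrow> complex^'n"
  assumes pa: "pa_structure (*s) brg brn p"
begin

lemma p_linear_right: "Vector_Spaces.linear (*s) (*s) (p x)"
  and p_linear_left: "Vector_Spaces.linear (*s) (*s) (\<lambda>x. p x y)"
  and p_commutator: "p x y - p y x = brg x y - brn x y"
  and p_brg: "p (brg x y) z = p x (p y z) - p y (p x z)"
  and p_brn: "p x (brn y z) = brn (p x y) z + brn y (p x z)"
  using pa by (simp_all add: pa_structure_def)

lemmas p_diff_right = vec.linear_diff[OF p_linear_right]
  and p_add_left = vec.linear_add[OF p_linear_left]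
  and p_scale_left = vec.linear_scale[OF p_linear_left]
  and p_neg_left = vec.linear_neg[OF p_linear_left]

text \<open>Equivalently, \<open>x \<mapsto> (E x, p x)\<close> is a homomorphism from the first Lie algebra to the semidirect product of the
  second one with its derivations.\<close>

definition crossed_hom :: "(complex^'n \<Rightarrow> complex^'n) \<Rightarrow> bool" where
  "crossed_hom E \<longleftrightarrow> Vector_Spaces.linear (*s) (*s) E \<and>
     (\<forall>x y. E (brg x y) = brn (E x) (E y) + p x (E y) - p y (E x))"

lemma crossed_hom_id: "crossed_hom (\<lambda>x. x)"
proof -
  have "brg x y = brn x y + p x y - p y x" for x y
    using p_commutator[of x y] by (simp add: algebra_simps)
  then show ?thesis
    using vec.linear_id by (simp add: crossed_hom_def id_def)
qed

text \<open>Conjugation by \<open>exp (- t y)\<close> in the semidirect product of \<open>\<nn>\<close> with its derivations leaves the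
  derivation part fixed and moves \<open>E\<close> along the flow of this differential equation. Its solution is a polynomial in \<open>t\<close>
  because \<open>{y, _}\<close> is nilpotent. All terms after \<open>E x + x \<cdot> y\<close> in the solution at time 1 contain a bracket
  with \<open>y\<close>.\<close>

lemma ex_base_point_flow:
  assumes "n.lower_central m = {0}" and E: "Vector_Spaces.linear (*s) (*s) E"
  shows "\<exists>F. F 0 = E \<and> (\<forall>t. Vector_Spaces.linear (*s) (*s) (F t)) \<and>
    (\<forall>t x. has_coordinate_derivative (\<lambda>t. F t x) (p x y - brn y (F t x)) t) \<and>
    (\<forall>k x. y \<in> n.lower_central k \<longrightarrow> F 1 x - (E x + p x y) \<in> n.lower_central (Suc k))"
proof -
  \<comment> \<open>The \<open>j\<close>-th derivative at \<open>t = 0\<close> of the solution.\<close>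
  define a where "a j = rec_nat E (\<lambda>j a x. (if j = 0 then p x y else 0) - brn y (a x)) j" for j :: nat
  have a_0: "a 0 = E" and a_Suc: "a (Suc j) x = (if j = 0 then p x y else 0) - brn y (a j x)" for j x
    by (simp_all add: a_def)
  have a_lower: "a (j + 1) x \<in> n.lower_central j" for j x
  proof (induction j)
    case (Suc j)
    then have "brn y (a (j + 1) x) \<in> n.lower_central (Suc j)"
      by (rule n.br_in_lower_central)
    then show ?case
      by (simp add: a_Suc vec.subspace_neg n.subspace_lower_central del: n.lower_central.simps)
  qed simp
  have a_linear: "Vector_Spaces.linear (*s) (*s) (a j)" for j
  proof (induction j)
    case 0
    show ?case using E by (simp add: a_0)
  next
    case (Suc j)
    then show ?case
      using vec.vector_space_axioms
      by (simp add: Vector_Spaces.linear_iff a_Suc p_add_left p_scale_left n.br_add_right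
          n.br_scale_right vector_sub_rdistrib vec.scale_right_diff_distrib)
  qed
  have a_end: "a (m + 1) x = 0" for x
    using a_lower[where j = m] assms(1) by simp
  define F where "F t x = (\<Sum>j\<le>m. (t ^ j / fact j) *s a j x)" for t x
  show ?thesis
  proof (intro exI[of _ F] conjI allI impI)
    have "F 0 x = E x" for x
    proof -
      have "F 0 x = (\<Sum>j\<le>m. if j = 0 then E x else 0)"
        unfolding F_def by (intro sum.cong) (auto simp: a_0)
      then show ?thesis by simp
    qed
    then show "F 0 = E" by blast
    show "Vector_Spaces.linear (*s) (*s) (F t)" for t
      unfolding F_def
      by (intro vec.linear_compose_sum ballI vec.linear_compose_scale_right a_linear)
    show "has_coordinate_derivative (\<lambda>t. F t x) (p x y - brn y (F t x)) t" for t x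
      unfolding has_coordinate_derivative_def
    proof
      fix i
      have "((\<lambda>t. \<Sum>j\<le>m. t ^ j / fact j * a j x $ i) has_field_derivative
          (\<Sum>j\<le>m. of_nat j * t ^ (j - 1) / fact j * a j x $ i)) (at t)"
        by (auto intro!: DERIV_sum derivative_eq_intros)
      also have "(\<Sum>j\<le>m. of_nat j * t ^ (j - 1) / fact j * a j x $ i)
          = (\<Sum>j\<le>Suc m. of_nat j * t ^ (j - 1) / fact j * a j x $ i)"
        using a_end by simp
      also have "\<dots> = (\<Sum>j\<le>m. t ^ j / fact j * a (Suc j) x $ i)"
        unfolding sum.atMost_Suc_shift
        by (simp add: field_simps del: of_nat_Suc)
      also have "\<dots> = (\<Sum>j\<le>m. (if j = 0 then p x y $ i else 0)
          - t ^ j / fact j * brn y (a j x) $ i)"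
        by (intro sum.cong) (auto simp: a_Suc algebra_simps)
      also have "\<dots> = (p x y - brn y (F t x)) $ i"
        by (simp add: sum_subtractf F_def vec.linear_sum[OF n.br_linear_right] n.br_scale_right)
      finally show "((\<lambda>t. F t x $ i) has_field_derivative (p x y - brn y (F t x)) $ i) (at t)"
        by (simp add: F_def)
    qed
    show "F 1 x - (E x + p x y) \<in> n.lower_central (Suc k)" if y: "y \<in> n.lower_central k" for k x
    proof -
      have "F 1 x = (\<Sum>j\<le>Suc m. (1 / fact j) *s a j x)"
        using a_end by (simp add: F_def)
      also have "\<dots> = E x + (\<Sum>j\<le>m. (1 / fact (Suc j)) *s a (Suc j) x)"
        by (subst sum.atMost_Suc_shift) (simp add: a_0 del: fact_Suc)
      also have "(\<Sum>j\<le>m. (1 / fact (Suc j)) *s a (Suc j) x)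
          = (\<Sum>j\<le>m. (if j = 0 then p x y else 0) - (1 / fact (Suc j)) *s brn y (a j x))"
        by (intro sum.cong) (auto simp: a_Suc vec.scale_right_diff_distrib)
      finally have "F 1 x - (E x + p x y) = - (\<Sum>j\<le>m. (1 / fact (Suc j)) *s brn y (a j x))"
        by (simp add: sum_subtractf)
      also have "\<dots> \<in> n.lower_central (Suc k)"
        by (intro vec.subspace_neg vec.subspace_sum vec.subspace_scale n.subspace_lower_central
            n.br_in_lower_central y)
      finally show ?thesis .
    qed
  qed
qed

text \<open>The defect of the crossed homomorphism identity satisfies the homogeneous equation \<open>u' = - {y, u}\<close>.\<close>

lemma crossed_hom_flow:
  assumes "n.nilpotent" "crossed_hom (F 0)" and F: "\<And>t. Vector_Spaces.linear (*s) (*s) (F t)"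
    and dF: "\<And>t x. has_coordinate_derivative (\<lambda>t. F t x) (p x y - brn y (F t x)) t"
  shows "crossed_hom (F t)"
proof -
  obtain k where k: "n.lower_central k = {0}"
    using assms(1) unfolding n.nilpotent_def by blast
  define N where "N v = - brn y v" for v
  have N_apply: "N v = - brn y v" for v
    by (simp add: N_def)
  have N: "Vector_Spaces.linear (*s) (*s) N"
    using vec.linear_compose_neg[OF n.br_linear_right, of y] by (simp add: N_def[abs_def])
  have "\<exists>c. (N ^^ j) v = c *s (brn y ^^ j) v" for j v
  proof (induction j)
    case 0
    show ?case by (intro exI[of _ 1]) simp
  next
    case (Suc j)
    then obtain c where "(N ^^ j) v = c *s (brn y ^^ j) v" by blast
    then show ?case
      by (intro exI[of _ "- c"]) (simp add: N_apply[of "c *s (brn y ^^ j) v"] n.br_scale_right)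
  qed
  then have N_nilpotent: "(N ^^ k) v = 0" for v
    using n.ad_power_in_lower_central[where y = y and k = k and v = v] k by (metis singletonD vec.scale_zero_right)
  have "F t (brg x z) - (brn (F t x) (F t z) + p x (F t z) - p z (F t x)) = 0" (is "?u t = 0") for x z
  proof (rule eq_0_if_derivative_nilpotent[OF N N_nilpotent])
    show "?u 0 = 0"
      using assms(2) by (simp add: crossed_hom_def)
    fix t
    have "has_coordinate_derivative ?u (p (brg x z) y - brn y (F t (brg x z)) -
        (brn (p x y - brn y (F t x)) (F t z) + brn (F t x) (p z y - brn y (F t z))
          + p x (p z y - brn y (F t z)) - p z (p x y - brn y (F t x)))) t" (is "has_coordinate_derivative _ ?u' _")
      by (intro has_coordinate_derivative_diff has_coordinate_derivative_add
          has_coordinate_derivative_bilinear[OF n.br_linear_right n.br_linear_left]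
          has_coordinate_derivative_linear[OF p_linear_right] dF)
    also have "?u' = N (?u t)"
    proof -
      have "brn (brn y (F t x)) (F t z) + brn (F t x) (brn y (F t z)) = brn y (brn (F t x) (F t z))"
        by (rule n.ad_derivation[symmetric])
      moreover have "brn (F t x) (p z y) = - brn (p z y) (F t x)"
        by (rule n.br_antisym)
      ultimately show ?thesis
        by (simp add: N_def p_brg p_brn p_diff_right n.br_diff_left n.br_diff_right n.br_add_right
            algebra_simps)
    qed
    finally show "has_coordinate_derivative ?u (N (?u t)) t" .
  qed
  then show ?thesis
    using F by (simp add: crossed_hom_def)
qed

text \<open>The square avoids a case distinction: the derivative \<open>2 d det (F t)\<close> of \<open>(det (F t))\<^sup>2\<close> vanishes where the
  determinant does, and elsewhere \<open>d = 0\<close> by Jacobi's formula, because the traces of \<open>p z\<close> and \<open>brg z\<close> vanish.\<close>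

lemma det_flow_constant:
  assumes perfect: "vec.span {brg x y |x y. True} = UNIV"
    and F: "\<And>t. crossed_hom (F t)"
    and dF: "\<And>t x. has_coordinate_derivative (\<lambda>t. F t x) (p x y - brn y (F t x)) t"
  shows "(det (matrix (F t)))\<^sup>2 = (det (matrix (F 0)))\<^sup>2"
proof -
  have F_linear: "Vector_Spaces.linear (*s) (*s) (F t)" for t
    using F by (simp add: crossed_hom_def)
  have "((\<lambda>t. (det (matrix (F t)))\<^sup>2) has_field_derivative 0) (at t)" for t
  proof -
    define A where "A = matrix (F t)"
    define A' where "A' = (\<chi> i j. (p (axis j 1) y - brn y (F t (axis j 1))) $ i)"
    define d where "d = (\<Sum>i\<in>UNIV. det (\<chi> k. if k = i then A' $ i else A $ k))"
    have "((\<lambda>t. det (matrix (F t))) has_field_derivative d) (at t)"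
      unfolding d_def A_def
      by (rule det_has_field_derivative)
        (use dF in \<open>simp add: matrix_def A'_def has_coordinate_derivative_def\<close>)
    moreover have "d = 0" if nonzero: "det A \<noteq> 0"
    proof -
      obtain B where B: "A ** B = mat 1" "B ** A = mat 1"
        using nonzero invertible_det_nz[of A] by (auto simp: invertible_def)
      \<comment> \<open>The element \<open>z = (F t)\<^sup>-\<^sup>1 y\<close>, for which the crossed homomorphism identity rewrites the derivative.\<close>
      define z where "z = B *v y"
      have Fz: "F t z = y"
        using B(1) matrix_works[OF F_linear, of t z]
        by (simp add: z_def A_def matrix_vector_mul_assoc)
      define Z where "Z = matrix (brg z)"
      define Pz where "Pz = matrix (p z)"
      have "p x y - brn y (F t x) = p z (F t x) - F t (brg z x)" for x
        using F[of t] n.br_antisym[of "F t x" y]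
        by (simp add: crossed_hom_def Fz)
      then have "A' = matrix (\<lambda>x. p z (F t x)) - matrix (\<lambda>x. F t (brg z x))"
        by (simp add: A'_def matrix_def vec_eq_iff)
      also have "\<dots> = Pz ** A - A ** Z"
        using matrix_compose_gen[OF F_linear[of t] p_linear_right[of z]]
          matrix_compose_gen[OF g.br_linear_right[of z] F_linear[of t]]
        by (simp add: o_def Pz_def A_def Z_def)
      also have "\<dots> = (Pz - A ** Z ** B) ** A"
      proof -
        have "(Pz - A ** Z ** B) ** A = Pz ** A - A ** Z ** B ** A"
          by (simp add: matrix_matrix_mult_def vec_eq_iff sum_subtractf left_diff_distrib)
        then show ?thesis
          using B(2) by (simp flip: matrix_mul_assoc)
      qed
      finally have A'_eq: "A' = (Pz - A ** Z ** B) ** A" .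
      have "d = trace (Pz - A ** Z ** B) * det A"
        unfolding d_def A'_eq by (rule sum_det_replace_row_matrix_mult)
      moreover have "trace (A ** Z ** B) = trace Z"
        using B(2) trace_mul_sym[of "A ** Z" B] by (simp add: matrix_mul_assoc)
      moreover have "trace Pz = 0"
        unfolding Pz_def
        using p_linear_right p_linear_left p_brg
        by (rule trace_representation_of_perfect_eq_0[OF perfect])
      moreover have "brg (brg x w) v = brg x (brg w v) - brg w (brg x v)" for x w v
        using g.jacobi[of x w v] g.br_antisym[of v "brg x w"] g.br_antisym[of v x]
        by (simp add: g.br_minus_right algebra_simps)
      then have "trace Z = 0"
        unfolding Z_def using g.br_linear_right g.br_linear_left
        by (intro trace_representation_of_perfect_eq_0[OF perfect])
      ultimately show ?thesis
        by (simp add: trace_sub)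
    qed
    ultimately show ?thesis
      by (auto intro!: derivative_eq_intros simp: A_def)
  qed
  then show ?thesis
    by (rule eq_if_derivative_0)
qed

text \<open>Modulo the next term of the lower central series, the change of base point by \<open>y\<close> adds the coboundary \<open>x \<mapsto> x \<cdot> y\<close>
  to \<open>E\<close>. Choose \<open>y\<close> by Whitehead's lemma such that it cancels the cocycle given by \<open>E\<close>.\<close>

lemma ex_crossed_hom_in_lower_central:
  assumes "n.nilpotent" and perfect: "vec.span {brg x y |x y. True} = UNIV"
    and triple: "brg e f = h" "brg h e = e + e" "brg h f = - (f + f)"
  shows "\<exists>E. crossed_hom E \<and> det (matrix E) \<noteq> 0 \<and> {E e, E f, E h} \<subseteq> n.lower_central k"
proof (induction k)
  case 0
  have "matrix (\<lambda>x. x) = (mat 1 :: complex^'n^'n)"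
    by (rule matrix_id_mat_1[unfolded id_def])
  then show ?case
    using crossed_hom_id by (intro exI[of _ "\<lambda>x. x"]) simp
next
  case (Suc k)
  then obtain E where E: "crossed_hom E" "det (matrix E) \<noteq> 0"
    and Ek: "E e \<in> n.lower_central k" "E f \<in> n.lower_central k" "E h \<in> n.lower_central k"
    by blast
  have E_linear: "Vector_Spaces.linear (*s) (*s) E"
    and E_brg: "E (brg x y) = brn (E x) (E y) + p x (E y) - p y (E x)" for x y
    using E(1) by (simp_all add: crossed_hom_def)
  interpret s: sl2_representation "(*s)" cart_basis "p e" "p f" "p h"
  proof (intro sl2_representation.intro sl2_representation_axioms.intro
      vec.finite_dimensional_vector_space_axioms p_linear_right)
    fix v
    show "p e (p f v) = p f (p e v) + p h v"
      using p_brg[of e f v] by (simp add: triple)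
    have "p (brg h e) v = p e v + p e v" "p (brg h f) v = - (p f v + p f v)"
      unfolding triple p_neg_left p_add_left by (rule refl)+
    then have *: "p h (p e v) = p e v + p e v + p e (p h v)"
        "p h (p f v) = - (p f v + p f v) + p f (p h v)"
      unfolding p_brg diff_eq_eq by this+
    show "p h (p e v) = p e (p h v) + p e v + p e v"
      unfolding *(1) by (simp only: add_ac)
    show "p h (p f v) = p f (p h v) - p f v - p f v"
      unfolding *(2) by (simp only: diff_conv_add_uminus minus_add_distrib add_ac)
  qed
  obtain m where m: "n.lower_central m = {0}"
    using assms(1) unfolding n.nilpotent_def by blast
  note sub = n.subspace_lower_central
  have "\<exists>y\<in>n.lower_central k. E e + p e y \<in> n.lower_central (Suc k) \<and>
      E f + p f y \<in> n.lower_central (Suc k) \<and> E h + p h y \<in> n.lower_central (Suc k)"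
  proof (rule s.ex_trivializing_vector_mod_subspace)
    have "brn (E e) (E f) \<in> n.lower_central (Suc k)" "brn (E h) (E e) \<in> n.lower_central (Suc k)"
      "brn (E h) (E f) \<in> n.lower_central (Suc k)"
      using Ek by (simp_all only: n.br_in_lower_central)
    note neg = this[THEN vec.subspace_neg[OF sub]]
    have "p e (E f) - p f (E e) - E h = - brn (E e) (E f)"
      using E_brg[of e f] by (simp add: triple)
    then show "p e (E f) - p f (E e) - E h \<in> n.lower_central (Suc k)"
      using neg(1) by (simp only:)
    have "E (brg h e) = E e + E e"
      by (simp only: triple vec.linear_add[OF E_linear])
    then have "p h (E e) - p e (E h) - (E e + E e) = - brn (E h) (E e)"
      using E_brg[of h e] by (simp add: algebra_simps)
    then show "p h (E e) - p e (E h) - (E e + E e) \<in> n.lower_central (Suc k)"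
      using neg(2) by (simp only:)
    have "E (brg h f) = - (E f + E f)"
      by (simp only: triple vec.linear_add[OF E_linear] vec.linear_neg[OF E_linear])
    then have "p h (E f) - p f (E h) + (E f + E f) = - brn (E h) (E f)"
      using E_brg[of h f] by (simp add: algebra_simps eq_neg_iff_add_eq_0)
    then show "p h (E f) - p f (E h) + (E f + E f) \<in> n.lower_central (Suc k)"
      using neg(3) by (simp only:)
  qed (use Ek in \<open>simp_all only: sub n.lower_central_Suc_subset
      n.derivation_lower_central[OF p_linear_right p_brn]\<close>)
  then obtain y where y: "y \<in> n.lower_central k"
    and "E e + p e y \<in> n.lower_central (Suc k)" "E f + p f y \<in> n.lower_central (Suc k)"
      "E h + p h y \<in> n.lower_central (Suc k)"
    by blast
  then have lower: "E x + p x y \<in> n.lower_central (Suc k)" if "x \<in> {e, f, h}" for x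
    using that by blast
  obtain F where F: "F 0 = E" "\<And>t. Vector_Spaces.linear (*s) (*s) (F t)"
    "\<And>t x. has_coordinate_derivative (\<lambda>t. F t x) (p x y - brn y (F t x)) t"
    and F_lower: "\<And>k x. y \<in> n.lower_central k \<Longrightarrow>
      F 1 x - (E x + p x y) \<in> n.lower_central (Suc k)"
    using ex_base_point_flow[where y = y, OF m E_linear] by blast
  have F_crossed: "crossed_hom (F t)" for t
    by (rule crossed_hom_flow[OF assms(1) _ F(2,3)]) (simp add: F(1) E(1))
  have "det (matrix (F 1)) \<noteq> 0"
    using det_flow_constant[OF perfect F_crossed F(3), of 1] F(1) E(2) by auto
  moreover have "F 1 x \<in> n.lower_central (Suc k)" if "x \<in> {e, f, h}" for x
    using vec.subspace_add[OF sub F_lower[OF y, of x] lower[OF that]]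
    by (simp only: diff_add_cancel)
  ultimately show ?case
    using F_crossed by (intro exI[of _ "F 1"]) blast
qed

text \<open>For \<open>k\<close> beyond the nilpotency class the crossed homomorphism of the previous lemma kills \<open>h\<close> and is
  injective.\<close>

theorem no_nonzero_sl2_triple:
  assumes "n.nilpotent" "vec.span {brg x y |x y. True} = UNIV"
    and "brg e f = h" "brg h e = e + e" "brg h f = - (f + f)"
  shows "h = 0"
proof -
  obtain k where "n.lower_central k = {0}"
    using assms(1) unfolding n.nilpotent_def by blast
  then obtain E where E: "crossed_hom E" "det (matrix E) \<noteq> 0" "E h = 0"
    using ex_crossed_hom_in_lower_central[OF assms, of k] by auto
  have E_linear: "Vector_Spaces.linear (*s) (*s) E"
    using E(1) by (simp add: crossed_hom_def)
  then have "inj E"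
    using E(2) by (simp add: det_nz_iff_inj_gen)
  then show ?thesis
    using E(3) vec.linear_0[OF E_linear] by (metis injD)
qed

end

section \<open>Transport along a linear bijection\<close>

lemma linear_inv_of_bij:
  assumes "Vector_Spaces.linear s1 s2 f" "bij f"
  shows "Vector_Spaces.linear s2 s1 (inv f)"
proof -
  interpret Vector_Spaces.linear s1 s2 f by (fact assms(1))
  have f_inv: "f (inv f y) = y" for y
    using assms(2) by (simp add: bij_is_surj surj_f_inv_f)
  show ?thesis
    unfolding Vector_Spaces.linear_iff
    using assms(2) vs1.vector_space_axioms vs2.vector_space_axioms
    by (auto intro!: injD[OF bij_is_inj[OF assms(2)]] simp: f_inv add scale)
qed

context lie_algebra
begin

context
  fixes s' :: "complex \<Rightarrow> 'b::ab_group_add \<Rightarrow> 'b" and \<psi> :: "'b \<Rightarrow> 'a"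
  assumes psi: "Vector_Spaces.linear s' sc \<psi>" "bij \<psi>"
begin

text \<open>Traces, determinants and derivatives live on \<open>complex^'n\<close>, so the structures of an abstract vector space are carried
  there.\<close>

definition pullback :: "'b \<Rightarrow> 'b \<Rightarrow> 'b" where
  "pullback u v = inv \<psi> (br (\<psi> u) (\<psi> v))"

interpretation \<psi>: Vector_Spaces.linear s' sc \<psi> by (fact psi(1))
interpretation inv: Vector_Spaces.linear sc s' "inv \<psi>" by (fact linear_inv_of_bij[OF psi])

lemma psi_inv [simp]: "\<psi> (inv \<psi> x) = x" and inv_psi [simp]: "inv \<psi> (\<psi> u) = u"
  using psi(2) by (simp_all add: bij_is_surj surj_f_inv_f bij_is_inj)

lemma lie_algebra_pullback: "lie_algebra s' pullback"
proof (intro lie_algebra.intro lie_algebra_axioms.intro \<psi>.vs1.vector_space_axioms)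
  show "Vector_Spaces.linear s' s' (pullback u)" "Vector_Spaces.linear s' s' (\<lambda>u. pullback u v)" for u v
    unfolding Vector_Spaces.linear_iff
    by (auto simp: \<psi>.vs1.vector_space_axioms pullback_def \<psi>.add \<psi>.scale br_add_left br_add_right
        br_scale_left br_scale_right inv.add inv.scale)
  show "pullback u u = 0" for u
    by (simp add: pullback_def br_alternating inv.zero)
  show "pullback u (pullback v w) + pullback v (pullback w u) + pullback w (pullback u v) = 0" for u v w
    using jacobi[of "\<psi> u" "\<psi> v" "\<psi> w"] by (simp add: pullback_def inv.zero flip: inv.add)
qed

interpretation pullback: lie_algebra s' pullback by (fact lie_algebra_pullback)

lemma lower_central_pullback: "pullback.lower_central k = inv \<psi> ` lower_central k"
proof (induction k)
  case 0
  show ?case using bij_is_surj[OF bij_imp_bij_inv[OF psi(2)]] by simp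
next
  case (Suc k)
  have "{pullback u v |u v. v \<in> inv \<psi> ` lower_central k} = inv \<psi> ` {br x y |x y. y \<in> lower_central k}"
  proof (intro equalityI subsetI)
    fix w assume "w \<in> inv \<psi> ` {br x y |x y. y \<in> lower_central k}"
    then obtain x y where "w = inv \<psi> (br x y)" "y \<in> lower_central k" by blast
    then have "w = pullback (inv \<psi> x) (inv \<psi> y)" "inv \<psi> y \<in> inv \<psi> ` lower_central k"
      by (simp_all add: pullback_def)
    then show "w \<in> {pullback u v |u v. v \<in> inv \<psi> ` lower_central k}" by blast
  next
    fix w assume "w \<in> {pullback u v |u v. v \<in> inv \<psi> ` lower_central k}"
    then obtain u y where "w = inv \<psi> (br (\<psi> u) y)" "y \<in> lower_central k"
      by (auto simp: pullback_def)
    then show "w \<in> inv \<psi> ` {br x y |x y. y \<in> lower_central k}" by blast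
  qed
  then show ?case
    by (simp add: Suc.IH inv.span_image)
qed

lemma nilpotent_pullback: "nilpotent \<Longrightarrow> pullback.nilpotent"
  unfolding nilpotent_def pullback.nilpotent_def lower_central_pullback
  by (metis image_empty image_insert inv.zero)

lemma span_brackets_pullback:
  assumes "span {br x y |x y. True} = UNIV"
  shows "\<psi>.vs1.span {pullback u v |u v. True} = UNIV"
proof -
  have "inv \<psi> ` {br x y |x y. True} \<subseteq> {pullback u v |u v. True}"
  proof
    fix w assume "w \<in> inv \<psi> ` {br x y |x y. True}"
    then obtain x y where "w = pullback (inv \<psi> x) (inv \<psi> y)"
      by (auto simp: pullback_def)
    then show "w \<in> {pullback u v |u v. True}" by blast
  qed
  then have "inv \<psi> ` span {br x y |x y. True} \<subseteq> \<psi>.vs1.span {pullback u v |u v. True}"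
    unfolding inv.span_image[symmetric] by (rule \<psi>.vs1.span_mono)
  then show ?thesis
    unfolding assms bij_is_surj[OF bij_imp_bij_inv[OF psi(2)]] by blast
qed

end

end

theorem no_pa_structure_if_perfect_with_sl2_triple:
  fixes \<psi> :: "complex^'n \<Rightarrow> 'a::ab_group_add"
  assumes "lie_algebra sc brg" "lie_algebra sc brn" "lie_algebra.nilpotent sc brn"
    and psi: "Vector_Spaces.linear (*s) sc \<psi>" "bij \<psi>"
    and perfect: "module.span sc {brg x y |x y. True} = UNIV"
    and triple: "brg e f = h" "brg h e = e + e" "brg h f = - (f + f)" "h \<noteq> 0"
  shows "\<not> pa_structure sc brg brn p"
proof
  assume pa: "pa_structure sc brg brn p"
  interpret G: lie_algebra sc brg by fact
  interpret N: lie_algebra sc brn by fact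
  interpret \<psi>: Vector_Spaces.linear "(*s)" sc \<psi> by (fact psi(1))
  interpret inv: Vector_Spaces.linear sc "(*s)" "inv \<psi>" by (fact linear_inv_of_bij[OF psi])
  note [simp] = G.psi_inv[OF psi] G.inv_psi[OF psi]
  define p' where "p' u v = inv \<psi> (p (\<psi> u) (\<psi> v))" for u v
  note pa' = pa[unfolded pa_structure_def Vector_Spaces.linear_iff]
  have "pa_structure (*s) (G.pullback \<psi>) (N.pullback \<psi>) p'"
    unfolding pa_structure_def
  proof (intro conjI allI)
    show "Vector_Spaces.linear (*s) (*s) (p' u)" "Vector_Spaces.linear (*s) (*s) (\<lambda>u. p' u v)" for u v
      unfolding Vector_Spaces.linear_iff
      using pa' by (auto simp: vec.vector_space_axioms p'_def \<psi>.add \<psi>.scale inv.add inv.scale)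
    show "p' u v - p' v u = G.pullback \<psi> u v - N.pullback \<psi> u v" for u v
      using pa' by (simp add: p'_def G.pullback_def[OF psi] N.pullback_def[OF psi] flip: inv.diff)
    show "p' (G.pullback \<psi> u v) w = p' u (p' v w) - p' v (p' u w)" for u v w
      using pa' by (simp add: p'_def G.pullback_def[OF psi] flip: inv.diff)
    show "p' u (N.pullback \<psi> v w) = N.pullback \<psi> (p' u v) w + N.pullback \<psi> v (p' u w)" for u v w
      using pa' by (simp add: p'_def N.pullback_def[OF psi] flip: inv.add)
  qed
  then interpret post_lie_pair "G.pullback \<psi>" "N.pullback \<psi>" p'
    using G.lie_algebra_pullback[OF psi] N.lie_algebra_pullback[OF psi]
    by (intro post_lie_pair.intro post_lie_pair_axioms.intro)
  have "inv \<psi> h = 0"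
  proof (rule no_nonzero_sl2_triple)
    show "lie_algebra.nilpotent (*s) (N.pullback \<psi>)"
      using N.nilpotent_pullback[OF psi] assms(3) by blast
    show "vec.span {G.pullback \<psi> u v |u v. True} = UNIV"
      using G.span_brackets_pullback[OF psi perfect] .
    show "G.pullback \<psi> (inv \<psi> e) (inv \<psi> f) = inv \<psi> h"
      "G.pullback \<psi> (inv \<psi> h) (inv \<psi> e) = inv \<psi> e + inv \<psi> e"
      "G.pullback \<psi> (inv \<psi> h) (inv \<psi> f) = - (inv \<psi> f + inv \<psi> f)"
      by (simp_all add: G.pullback_def[OF psi] triple inv.add inv.neg inv.diff)
  qed
  then show False
    using triple(4) \<psi>.zero by (metis G.psi_inv[OF psi])
qed

section \<open>The two semidirect products\<close>

interpretation semidirect: vector_space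
    "semidirect_scale :: complex \<Rightarrow> _ \<Rightarrow> (complex^2^2) \<times> (complex^'n)"
  by (fact vector_space_semidirect_scale)

definition sl2_e :: "complex^2^2" where "sl2_e = vector [vector [0, 1], vector [0, 0]]"
definition sl2_f :: "complex^2^2" where "sl2_f = vector [vector [0, 0], vector [1, 0]]"
definition sl2_h :: "complex^2^2" where "sl2_h = vector [vector [1, 0], vector [0, -1]]"

lemmas sl2_simps = sl2_def sl2_e_def sl2_f_def sl2_h_def commutator_def matrix_matrix_mult_def
  mscale_def trace_def vec_eq_iff forall_2 sum_2

lemma sl2_triple_in_sl2: "sl2_e \<in> sl2" "sl2_f \<in> sl2" "sl2_h \<in> sl2" and zero_in_sl2: "0 \<in> sl2"
  by (simp_all add: sl2_simps)

lemma sl2_triple_commutators: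
  "commutator sl2_e sl2_f = sl2_h"
  "commutator sl2_h sl2_e = sl2_e + sl2_e"
  "commutator sl2_h sl2_f = - (sl2_f + sl2_f)"
  by (simp_all add: sl2_simps)

lemma semidirect_bracket_sl2:
  assumes "\<And>A. A \<in> sl2 \<Longrightarrow> \<rho> A 0 = 0" "b 0 0 = 0" "A \<in> sl2" "B \<in> sl2"
  shows "semidirect_bracket \<rho> b (A, 0) (B, 0) = (commutator A B, 0)"
  using assms by (simp add: semidirect_bracket_def)

theorem no_pa_structure_if_perfect_semidirect:
  fixes sc :: "complex \<Rightarrow> 'a::ab_group_add \<Rightarrow> 'a"
    and \<rho> :: "complex^2^2 \<Rightarrow> complex^'n \<Rightarrow> complex^'n"
  assumes "lie_algebra sc brg" "lie_algebra sc brn" "lie_algebra.nilpotent sc brn"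
    and iso: "lie_isomorphic sc brg semidirect_scale (sl2 \<times> UNIV) (semidirect_bracket \<rho> b)"
    and zero: "\<And>A. A \<in> sl2 \<Longrightarrow> \<rho> A 0 = 0" "b 0 0 = 0"
    and perfect: "sl2 \<times> UNIV \<subseteq> semidirect.span
      {semidirect_bracket \<rho> b X Y |X Y. X \<in> sl2 \<times> UNIV \<and> Y \<in> sl2 \<times> UNIV}"
  shows "\<not> pa_structure sc brg brn p"
proof -
  obtain \<phi> where phi: "Vector_Spaces.linear sc semidirect_scale \<phi>" "bij_betw \<phi> UNIV (sl2 \<times> UNIV)"
    and hom: "\<And>x y. \<phi> (brg x y) = semidirect_bracket \<rho> b (\<phi> x) (\<phi> y)"
    using iso unfolding lie_isomorphic_def by blast
  interpret g: lie_algebra sc brg by fact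
  interpret \<phi>: Vector_Spaces.linear sc semidirect_scale \<phi> by (fact phi(1))
  have inj: "inj \<phi>" and range: "range \<phi> = sl2 \<times> UNIV"
    using phi(2) by (auto simp: bij_betw_def)
  \<comment> \<open>Coordinates of \<open>sl2 \<times> UNIV\<close>; the second diagonal entry is determined by the trace condition.\<close>
  define coords where
    "coords v = (vector [vector [v $ Inl 1, v $ Inl 2], vector [v $ Inl 3, - v $ Inl 1]] :: complex^2^2,
      \<chi> i. v $ Inr i)" for v :: "complex^(3 + 'n)"
  have coords_range: "coords v \<in> range \<phi>" for v
    by (simp add: range coords_def sl2_simps)
  define \<psi> where "\<psi> v = inv \<phi> (coords v)" for v
  have phi_psi: "\<phi> (\<psi> v) = coords v" for v
    using coords_range by (simp add: \<psi>_def f_inv_into_f)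
  have "Vector_Spaces.linear (*s) sc \<psi>"
    unfolding Vector_Spaces.linear_iff
  proof (intro conjI allI vec.vector_space_axioms g.vector_space_axioms)
    show "\<psi> (u + v) = \<psi> u + \<psi> v" for u v
      by (rule injD[OF inj])
        (simp add: phi_psi \<phi>.add coords_def vec_eq_iff forall_2)
    show "\<psi> (c *s v) = sc c (\<psi> v)" for c v
      by (rule injD[OF inj])
        (simp add: phi_psi \<phi>.scale coords_def semidirect_scale_def mscale_def vec_eq_iff forall_2)
  qed
  moreover have "bij \<psi>"
  proof (rule bijI)
    show "inj \<psi>"
    proof (rule injI)
      fix u v assume "\<psi> u = \<psi> v"
      then have "coords u = coords v"
        by (metis phi_psi)
      then show "u = v"
        by (simp add: coords_def vec_eq_iff forall_2 split_sum_all forall_3)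
    qed
    show "surj \<psi>"
    proof -
      have "x \<in> range \<psi>" for x
      proof -
        obtain A w where Aw: "\<phi> x = (A, w)" "A \<in> sl2"
          using range by (metis SigmaE rangeI)
        let ?v = "(\<chi> k. case k of Inl i \<Rightarrow> if i = 1 then A $ 1 $ 1 else if i = 2 then A $ 1 $ 2 else A $ 2 $ 1
          | Inr i \<Rightarrow> w $ i) :: complex^(3 + 'n)"
        have "coords ?v = \<phi> x"
          using Aw by (simp add: coords_def sl2_simps neg_eq_iff_add_eq_0)
        then have "\<psi> ?v = x"
          by (intro injD[OF inj]) (simp only: phi_psi)
        then show ?thesis by blast
      qed
      then show ?thesis by blast
    qed
  qed
  moreover have "g.span {brg x y |x y. True} = UNIV"
  proof -
    have "{semidirect_bracket \<rho> b X Y |X Y. X \<in> sl2 \<times> UNIV \<and> Y \<in> sl2 \<times> UNIV}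
        \<subseteq> \<phi> ` {brg x y |x y. True}"
    proof
      fix Z
      assume "Z \<in> {semidirect_bracket \<rho> b X Y |X Y. X \<in> sl2 \<times> UNIV \<and> Y \<in> sl2 \<times> UNIV}"
      then obtain x y where "Z = \<phi> (brg x y)"
        unfolding range[symmetric] hom by blast
      then show "Z \<in> \<phi> ` {brg x y |x y. True}" by blast
    qed
    from subset_trans[OF perfect semidirect.span_mono[OF this]]
    have "range \<phi> \<subseteq> \<phi> ` g.span {brg x y |x y. True}"
      unfolding \<phi>.span_image range .
    then show ?thesis
      unfolding inj_image_subset_iff[OF inj] by blast
  qed
  moreover define lift where "lift A = inv \<phi> (A, 0)" for A
  have phi_lift: "\<phi> (lift A) = (A, 0)" if "A \<in> sl2" for A
    using that range by (simp add: lift_def f_inv_into_f)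
  have brg_lift: "brg (lift A) (lift B) = lift C"
    if "A \<in> sl2" "B \<in> sl2" "C \<in> sl2" "commutator A B = C" for A B C
    using that by (intro injD[OF inj]) (simp add: hom phi_lift semidirect_bracket_sl2 zero)
  have lift_add: "lift (A + B) = lift A + lift B" and lift_minus: "lift (- A) = - lift A"
    if "A \<in> sl2" "B \<in> sl2" for A B
  proof -
    have "A + B \<in> sl2" "- A \<in> sl2"
      using that by (simp_all add: sl2_def trace_add) (simp add: trace_def sum_negf)
    then show "lift (A + B) = lift A + lift B" "lift (- A) = - lift A"
      using that by (auto intro!: injD[OF inj] simp: phi_lift \<phi>.add \<phi>.neg)
  qed
  have in_sl2: "sl2_e + sl2_e \<in> sl2" "sl2_f + sl2_f \<in> sl2" "- (sl2_f + sl2_f) \<in> sl2"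
    by (simp_all add: sl2_simps)
  have "brg (lift sl2_e) (lift sl2_f) = lift sl2_h"
    "brg (lift sl2_h) (lift sl2_e) = lift sl2_e + lift sl2_e"
    "brg (lift sl2_h) (lift sl2_f) = - (lift sl2_f + lift sl2_f)"
    using brg_lift[OF sl2_triple_in_sl2(1,2,3) sl2_triple_commutators(1)]
      brg_lift[OF sl2_triple_in_sl2(3,1) in_sl2(1) sl2_triple_commutators(2)]
      brg_lift[OF sl2_triple_in_sl2(3,2) in_sl2(3) sl2_triple_commutators(3)]
      lift_add[OF sl2_triple_in_sl2(1,1)] lift_add[OF sl2_triple_in_sl2(2,2)]
      lift_minus[OF in_sl2(2,2)]
    by metis+
  moreover have "lift sl2_h \<noteq> 0"
  proof
    assume "lift sl2_h = 0"
    then have "(sl2_h, 0) = (0 :: (complex^2^2) \<times> (complex^'n))"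
      using phi_lift[OF sl2_triple_in_sl2(3)] \<phi>.zero by simp
    then show False
      by (simp add: zero_prod_def sl2_simps)
  qed
  ultimately show ?thesis
    by (rule no_pa_structure_if_perfect_with_sl2_triple[OF assms(1-3)])
qed

text \<open>The standard triple consists of commutators, up to scalars.\<close>

lemma sl2_in_subspace_containing_brackets:
  assumes W: "semidirect.subspace W"
    and brackets: "\<And>X Y. X \<in> sl2 \<times> UNIV \<Longrightarrow> Y \<in> sl2 \<times> UNIV \<Longrightarrow> semidirect_bracket \<rho> b X Y \<in> W"
    and zero: "\<And>A. A \<in> sl2 \<Longrightarrow> \<rho> A 0 = 0" "b 0 0 = 0"
    and "A \<in> sl2"
  shows "(A, 0) \<in> W"
proof -
  have commutator: "(commutator A B, 0) \<in> W" if "A \<in> sl2" "B \<in> sl2" for A B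
    using brackets[of "(A, 0)" "(B, 0)"] that by (simp add: semidirect_bracket_sl2 zero)
  have "(A, 0) = semidirect_scale (A $ 1 $ 1) (commutator sl2_e sl2_f, 0)
      + semidirect_scale (A $ 1 $ 2 / 2) (commutator sl2_h sl2_e, 0)
      + semidirect_scale (- A $ 2 $ 1 / 2) (commutator sl2_h sl2_f, 0)"
    using \<open>A \<in> sl2\<close>
    by (simp add: semidirect_scale_def sl2_simps eq_neg_iff_add_eq_0 add.commute)
  also have "\<dots> \<in> W"
    by (intro semidirect.subspace_add semidirect.subspace_scale W commutator sl2_triple_in_sl2)
  finally show ?thesis .
qed

lemma module_part_subspace:
  fixes W :: "((complex^2^2) \<times> (complex^'n)) set"
  assumes "semidirect.subspace W"
  shows "vec.subspace {v. (0, v) \<in> W}"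
proof -
  have zero: "(0, 0) \<in> W"
    using semidirect.subspace_0[OF assms] by (simp add: zero_prod_def)
  have add: "(0, v + w) \<in> W" if "(0, v) \<in> W" "(0, w) \<in> W" for v w
    using semidirect.subspace_add[OF assms that] by simp
  have "(0, c *s v) = semidirect_scale c (0, v)" for c and v :: "complex^'n"
    by (simp add: semidirect_scale_def mscale_def vec_eq_iff)
  then have scale: "(0, c *s v) \<in> W" if "(0, v) \<in> W" for c v
    using semidirect.subspace_scale[OF assms that] by simp
  show ?thesis
    unfolding vec.subspace_def using zero add scale by blast
qed

lemma semidirect_subset_if_parts:
  fixes W :: "((complex^2^2) \<times> (complex^'n)) set"
  assumes "semidirect.subspace W" "\<And>A. A \<in> sl2 \<Longrightarrow> (A, 0) \<in> W" "\<And>v. (0, v) \<in> W"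
  shows "sl2 \<times> UNIV \<subseteq> W"
proof
  fix X :: "(complex^2^2) \<times> (complex^'n)"
  assume "X \<in> sl2 \<times> UNIV"
  moreover have "X = (fst X, 0) + (0, snd X)"
    by simp
  ultimately show "X \<in> W"
    using semidirect.subspace_add[OF assms(1)] assms(2,3) by (metis mem_Times_iff)
qed

text \<open>The vectors \<open>v\<close> with \<open>(0, v)\<close> in the derived algebra form a submodule that contains every \<open>\<rho> A v\<close>. If it were
  zero, the action would be trivial and every subspace a submodule, contrary to irreducibility in dimension 3.\<close>

lemma perfect_irreducible_semidirect:
  fixes \<rho> :: "complex^2^2 \<Rightarrow> complex^3 \<Rightarrow> complex^3"
  assumes irr: "irreducible_sl2_module \<rho>"
  shows "sl2 \<times> UNIV \<subseteq> semidirect.span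
    {semidirect_bracket \<rho> (\<lambda>_ _. 0) X Y |X Y. X \<in> sl2 \<times> UNIV \<and> Y \<in> sl2 \<times> UNIV}"
    (is "_ \<subseteq> ?W")
proof (rule semidirect_subset_if_parts)
  have linear_rho: "Vector_Spaces.linear (*s) (*s) (\<rho> A)" if "A \<in> sl2" for A
    using irr that by (simp add: irreducible_sl2_module_def sl2_module_def)
  have zero: "\<rho> A 0 = 0" if "A \<in> sl2" for A
    using linear_rho[OF that] by (rule vec.linear_0)
  have brackets: "semidirect_bracket \<rho> (\<lambda>_ _. 0) X Y \<in> ?W"
    if "X \<in> sl2 \<times> UNIV" "Y \<in> sl2 \<times> UNIV" for X Y
    using that by (intro semidirect.span_base) blast
  show W: "semidirect.subspace ?W"
    by (rule semidirect.subspace_span)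
  show "(A, 0) \<in> ?W" if "A \<in> sl2" for A
    using sl2_in_subspace_containing_brackets[OF W brackets zero _ that] by simp
  define U where "U = {v. (0, v) \<in> ?W}"
  have image: "\<rho> A v \<in> U" if "A \<in> sl2" for A v
    using brackets[of "(A, 0)" "(0, v)"] that zero_in_sl2
    by (simp add: semidirect_bracket_def commutator_def zero U_def)
  have "U = {0} \<or> U = UNIV"
    using irr image module_part_subspace[OF W] unfolding irreducible_sl2_module_def U_def by blast
  moreover have "U \<noteq> {0}"
  proof
    assume "U = {0}"
    then have "\<rho> A v = 0" if "A \<in> sl2" for A v
      using image[OF that] by simp
    \<comment> \<open>A plane: a proper nonzero subspace.\<close>
    moreover define H where "H = {v :: complex^3. v $ 1 = 0}"
    have "vec.subspace H"
      by (simp add: vec.subspace_def H_def)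
    ultimately have "H = {0} \<or> H = UNIV"
      using irr vec.subspace_0 unfolding irreducible_sl2_module_def by metis
    moreover have "axis 2 1 \<in> H" "axis 1 1 \<notin> H"
      by (simp_all add: H_def axis_def)
    ultimately show False
      by (auto simp: axis_eq_0_iff)
  qed
  ultimately show "(0, v) \<in> ?W" for v
    by (auto simp: U_def)
qed

lemma perfect_sl2_n3:
  "sl2 \<times> UNIV \<subseteq> semidirect.span {sl2_n3_bracket X Y |X Y. X \<in> sl2 \<times> UNIV \<and> Y \<in> sl2 \<times> UNIV}"
    (is "_ \<subseteq> ?W")
proof (rule semidirect_subset_if_parts)
  have brackets: "sl2_n3_bracket X Y \<in> ?W" if "X \<in> sl2 \<times> UNIV" "Y \<in> sl2 \<times> UNIV" for X Y
    using that by (intro semidirect.span_base) blast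
  show W: "semidirect.subspace ?W"
    by (rule semidirect.subspace_span)
  show "(A, 0) \<in> ?W" if "A \<in> sl2" for A
    using that by (intro sl2_in_subspace_containing_brackets[OF W brackets])
      (simp_all add: heisenberg_action_def heisenberg_bracket_def vec_eq_iff forall_3)
  fix v :: "complex^3"
  have basis: "(0, vector [1, 0, 0]) \<in> ?W" "(0, vector [0, 1, 0]) \<in> ?W" "(0, vector [0, 0, 1]) \<in> ?W"
    using brackets[of "(sl2_e, 0)" "(0, vector [0, 1, 0])"]
      brackets[of "(sl2_f, 0)" "(0, vector [1, 0, 0])"]
      brackets[of "(0, vector [1, 0, 0])" "(0, vector [0, 1, 0])"]
    using sl2_triple_in_sl2 zero_in_sl2 unfolding sl2_e_def sl2_f_def sl2_n3_table
    by simp_all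
  have "v = v $ 1 *s vector [1, 0, 0] + v $ 2 *s vector [0, 1, 0] + v $ 3 *s vector [0, 0, 1]"
    by (simp add: vec_eq_iff forall_3)
  also have "\<dots> \<in> {v. (0, v) \<in> ?W}"
    using basis by (intro vec.subspace_add vec.subspace_scale module_part_subspace W) simp_all
  finally show "(0, v) \<in> ?W" by simp
qed

theorem proposition3p2:
  fixes sc :: "complex \<Rightarrow> 'a::ab_group_add \<Rightarrow> 'a"
    and brg brn :: "'a \<Rightarrow> 'a \<Rightarrow> 'a"
  assumes "lie_algebra sc brg"
    and "lie_algebra sc brn"
    and "iso_sl2_V3 sc brg \<or> iso_sl2_n3 sc brg"
    and "lie_algebra.nilpotent sc brn"
  shows "\<not> (\<exists>p. pa_structure sc brg brn p)"
  using assms(3)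
proof
  assume "iso_sl2_V3 sc brg"
  then obtain \<rho> :: "complex^2^2 \<Rightarrow> complex^3 \<Rightarrow> complex^3" where rho: "irreducible_sl2_module \<rho>"
    and iso: "lie_isomorphic sc brg semidirect_scale (sl2 \<times> UNIV) (semidirect_bracket \<rho> (\<lambda>_ _. 0))"
    unfolding iso_sl2_V3_def by blast
  have "\<rho> A 0 = 0" if "A \<in> sl2" for A
    using rho that vec.linear_0[of "\<rho> A"] by (simp add: irreducible_sl2_module_def sl2_module_def)
  then show ?thesis
    using no_pa_structure_if_perfect_semidirect[OF assms(1,2,4) iso]
      perfect_irreducible_semidirect[OF rho] by blast
next
  assume "iso_sl2_n3 sc brg"
  then have iso: "lie_isomorphic sc brg semidirect_scale (sl2 \<times> UNIV) sl2_n3_bracket"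
    unfolding iso_sl2_n3_def .
  have "heisenberg_action A 0 = 0" "heisenberg_bracket 0 0 = 0" for A
    by (simp_all add: heisenberg_action_def heisenberg_bracket_def vec_eq_iff forall_3)
  then show ?thesis
    using no_pa_structure_if_perfect_semidirect[OF assms(1,2,4) iso] perfect_sl2_n3 by blast
qed

end
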